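(* The class of intersection graphs of simple families of $x$-monotone curves in the plane all of whose members intersect a common vertical line is $\chi$-bounded. That is, there exists a function $f:\mathbb{N}\to\mathbb{N}$ such that for every simple family $\mathcal{F}$ of $x$-monotone curves in the plane for which there is a vertical line intersecting every member of $\mathcal{F}$, the intersection graph $G(\mathcal{F})$ satisfies $\chi(G(\mathcal{F}))\le f(\omega(G(\mathcal{F})))$.
   Context: All families of curves and all graphs are finite. For a graph $G$, $\chi(G)$ is its chromatic number and $\omega(G)$ its clique number. A class $\mathcal{G}$ of graphs is $\chi$-bounded if there is a function $f:\mathbb{N}\to\mathbb{N}$ such that $\chi(G)\le f(\omega(G))$ for every $G\in\mathcal{G}$. For a family $\mathcal{F}$ of sets in the plane, the intersection graph $G(\mathcal{F})$ has vertex set $\mathcal{F}$, with two members adjacent if and only if they have nonempty intersection. A curve is $x$-monotone if every vertical line meets it in at most one point. A family of curves is simple if every pair of its members intersect at most once (in at most one point) and no two members are tangent, i.e. if two curves have a common interior point, they must properly cross at that point. *)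

theory Defs
  imports "HOL-Analysis.Analysis" "HOL-Library.Ramsey"
begin

type_synonym 'a graph = "'a set \<times> 'a set set"

definition proper_colouring :: "'a graph \<Rightarrow> nat \<Rightarrow> ('a \<Rightarrow> nat) \<Rightarrow> bool" where
  "proper_colouring G k c \<longleftrightarrow>
     (\<forall>v\<in>fst G. c v < k) \<and>
     (\<forall>u\<in>fst G. \<forall>v\<in>fst G. u \<noteq> v \<and> {u, v} \<in> snd G \<longrightarrow> c u \<noteq> c v)"

(* Meaningful for finite graphs; the classes considered below consist of finite graphs. *)
definition chromatic_number :: "'a graph \<Rightarrow> nat" where
  "chromatic_number G = (LEAST k. \<exists>c. proper_colouring G k c)"

definition clique_number :: "'a graph \<Rightarrow> nat" where
  "clique_number G = Max {card K | K. K \<subseteq> fst G \<and> clique K (snd G)}"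

definition chi_bounded :: "'a graph set \<Rightarrow> bool" where
  "chi_bounded \<G> \<longleftrightarrow>
     (\<exists>f :: nat \<Rightarrow> nat. \<forall>G\<in>\<G>. chromatic_number G \<le> f (clique_number G))"

definition intersection_graph :: "'p set set \<Rightarrow> 'p set graph" where
  "intersection_graph F =
     (F, {{C, D} | C D. C \<in> F \<and> D \<in> F \<and> C \<noteq> D \<and> C \<inter> D \<noteq> {}})"

type_synonym plane = "real \<times> real"

(* A curve is identified with its point set. *)
definition curve :: "plane set \<Rightarrow> bool" where
  "curve C \<longleftrightarrow> (\<exists>g. arc g \<and> path_image g = C)"

(* Reversing a parametrisation exchanges start and finish, so both endpoints are captured. *)
definition curve_endpoints :: "plane set \<Rightarrow> plane set" where
  "curve_endpoints C = {pathstart g | g. arc g \<and> path_image g = C}"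

definition curve_interior :: "plane set \<Rightarrow> plane set" where
  "curve_interior C = C - curve_endpoints C"

definition vertical_line :: "real \<Rightarrow> plane set" where
  "vertical_line a = {p. fst p = a}"

definition x_monotone :: "plane set \<Rightarrow> bool" where
  "x_monotone C \<longleftrightarrow> (\<forall>a. \<forall>p \<in> C \<inter> vertical_line a. \<forall>q \<in> C \<inter> vertical_line a. p = q)"

(* Near p each of the two curves passes from one side of the other to the opposite side:
   up to a local change of coordinates they look like the two coordinate axes.
   For graphs of continuous functions u and v this says that u - v changes sign at p. *)
definition properly_cross_at :: "plane set \<Rightarrow> plane set \<Rightarrow> plane \<Rightarrow> bool" where
  "properly_cross_at C D p \<longleftrightarrow>
     (\<exists>U (h :: plane \<Rightarrow> plane) k. open U \<and> p \<in> U \<and> homeomorphism U UNIV h k \<and> h p = (0, 0) \<and>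
        h ` (C \<inter> U) = {z. snd z = 0} \<and> h ` (D \<inter> U) = {z. fst z = 0})"

definition simple_family :: "plane set set \<Rightarrow> bool" where
  "simple_family F \<longleftrightarrow>
     (\<forall>C\<in>F. curve C) \<and>
     (\<forall>C\<in>F. \<forall>D\<in>F. C \<noteq> D \<longrightarrow>
        (\<forall>p \<in> C \<inter> D. \<forall>q \<in> C \<inter> D. p = q) \<and>
        (\<forall>p \<in> curve_interior C \<inter> curve_interior D. properly_cross_at C D p))"

end

(* The parts of the curves on one side of the line are graphs of functions starting on the line,
   and the intersection graph is the union of the two intersection graphs of these parts; so it
   suffices to colour each of these. Two such graphs of functions cross at most once, hence meet if
   and only if their order at the end of the shorter one differs from the order of their starting
   points. By induction on the clique number, neighbourhoods have bounded chromatic number c.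

   If the chromatic number is huge, some layer of a breadth-first search contains adjacent vertices
   u < v between which the chromatic number remains huge. Apart from neighbours of u and v, the
   vertices between them are trapped in the pocket enclosed by u and v, so that their
   neighbours in the previous layer, the supports, have to leave the pocket through u or v.
   Iterating inside the pocket yields many levels of supports. Either the supports start outside
   the pocket, always on the same side: then c + 1 levels bound the chromatic number, since two
   levels contain supports of equal colour. Or they start inside: then they can be taken to be
   disjoint walls attached to u (or v), and k levels of walls yield a clique of size k + 1. *)

theory Submission
  imports Defs
begin

section \<open>Colourings\<close>

definition colourable :: "('a \<Rightarrow> 'a \<Rightarrow> bool) \<Rightarrow> 'a set \<Rightarrow> nat \<Rightarrow> bool" where
  "colourable adj X n \<longleftrightarrow>
     (\<exists>\<kappa>. (\<forall>x\<in>X. \<kappa> x < n) \<and> (\<forall>x\<in>X. \<forall>y\<in>X. adj x y \<longrightarrow> \<kappa> x \<noteq> \<kappa> y))"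

lemma colourable_mono:
  assumes "colourable adj Y n" "X \<subseteq> Y" "n \<le> m"
  shows "colourable adj X m"
proof -
  obtain \<kappa> where "\<forall>x\<in>Y. \<kappa> x < n" "\<forall>x\<in>Y. \<forall>y\<in>Y. adj x y \<longrightarrow> \<kappa> x \<noteq> \<kappa> y"
    using assms(1) unfolding colourable_def by blast
  then have "\<forall>x\<in>X. \<kappa> x < m" "\<forall>x\<in>X. \<forall>y\<in>X. adj x y \<longrightarrow> \<kappa> x \<noteq> \<kappa> y"
    using assms(2,3) by (blast intro: less_le_trans)+
  then show ?thesis unfolding colourable_def by blast
qed

lemma colourable_independent:
  assumes "\<And>x y. x \<in> X \<Longrightarrow> y \<in> X \<Longrightarrow> \<not> adj x y"
  shows "colourable adj X 1"
  unfolding colourable_def using assms by (intro exI[of _ "\<lambda>_. 0"]) auto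

lemma ex_min_key:
  fixes key :: "'a \<Rightarrow> real"
  assumes "finite Q" "Q \<noteq> {}"
  shows "\<exists>x\<in>Q. \<forall>y\<in>Q. key x \<le> key y"
  by (metis arg_min_if_finite(1) arg_min_least assms)

lemma colourable_Un:
  assumes "colourable adj X m" "colourable adj Y n"
  shows "colourable adj (X \<union> Y) (m + n)"
proof -
  obtain \<kappa> where \<kappa>: "\<forall>x\<in>X. \<kappa> x < m" "\<forall>x\<in>X. \<forall>y\<in>X. adj x y \<longrightarrow> \<kappa> x \<noteq> \<kappa> y"
    using assms(1) unfolding colourable_def by blast
  obtain \<mu> where \<mu>: "\<forall>x\<in>Y. \<mu> x < n" "\<forall>x\<in>Y. \<forall>y\<in>Y. adj x y \<longrightarrow> \<mu> x \<noteq> \<mu> y"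
    using assms(2) unfolding colourable_def by blast
  let ?c = "\<lambda>x. if x \<in> X then \<kappa> x else m + \<mu> x"
  have "\<forall>x\<in>X \<union> Y. ?c x < m + n"
    using \<kappa>(1) \<mu>(1) by (auto simp: trans_less_add1)
  moreover have "\<forall>x\<in>X \<union> Y. \<forall>y\<in>X \<union> Y. adj x y \<longrightarrow> ?c x \<noteq> ?c y"
  proof (intro ballI impI)
    fix x y assume "x \<in> X \<union> Y" "y \<in> X \<union> Y" "adj x y"
    then show "?c x \<noteq> ?c y"
      using \<kappa>(1)[rule_format, of x] \<kappa>(1)[rule_format, of y] \<kappa>(2) \<mu>(2)
      by (cases "x \<in> X"; cases "y \<in> X") auto
  qed
  ultimately show ?thesis unfolding colourable_def by (intro exI[of _ ?c] conjI)
qed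

lemma colourable_UN:
  assumes "finite I" "\<And>i. i \<in> I \<Longrightarrow> colourable adj (X i) n"
  shows "colourable adj (\<Union>i\<in>I. X i) (card I * n)"
  using assms
proof (induction I rule: finite_induct)
  case empty
  show ?case by (simp add: colourable_def)
next
  case (insert i I)
  have "colourable adj (X i \<union> (\<Union>i\<in>I. X i)) (n + card I * n)"
    using insert by (intro colourable_Un) auto
  then show ?case using insert by simp
qed

text \<open>Cut the ordered set greedily into blocks, each consisting of the elements that its
  first element \<open>R\<close>-reaches: edges then join only equal or consecutive blocks.\<close>

lemma colourable_blocks:
  fixes key :: "'a \<Rightarrow> real"
  assumes fin: "finite P" and inj: "inj_on key P"
    and irr: "\<And>x. \<not> adj x x" and sym: "\<And>x y. adj x y \<Longrightarrow> adj y x"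
    and edge: "\<And>p q. p \<in> P \<Longrightarrow> q \<in> P \<Longrightarrow> key p < key q \<Longrightarrow> adj p q \<Longrightarrow> R p q"
    and mono1: "\<And>p p' q. p \<in> P \<Longrightarrow> p' \<in> P \<Longrightarrow> q \<in> P \<Longrightarrow> key p \<le> key p' \<Longrightarrow> key p' < key q \<Longrightarrow>
                  R p q \<Longrightarrow> R p' q"
    and mono2: "\<And>p q q'. p \<in> P \<Longrightarrow> q \<in> P \<Longrightarrow> q' \<in> P \<Longrightarrow> key p < key q' \<Longrightarrow> key q' \<le> key q \<Longrightarrow>
                  R p q \<Longrightarrow> R p q'"
    and block: "\<And>x. x \<in> P \<Longrightarrow> colourable adj {q \<in> P. q = x \<or> key x < key q \<and> R x q} n"
  shows "colourable adj P (2 * n)"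
proof -
  have main: "\<exists>\<kappa>. (\<forall>x\<in>Q. \<kappa> x < 2 * n) \<and> (\<forall>x\<in>Q. \<forall>y\<in>Q. adj x y \<longrightarrow> \<kappa> x \<noteq> \<kappa> y) \<and>
      (\<forall>x\<in>Q. \<forall>q\<in>Q. (\<forall>y\<in>Q. key x \<le> key y) \<and> (q = x \<or> key x < key q \<and> R x q) \<longrightarrow> \<kappa> q < n)"
    if "Q \<subseteq> P" for Q
    using that
  proof (induction "card Q" arbitrary: Q rule: less_induct)
    case less
    show ?case
    proof (cases "Q = {}")
      case True
      then show ?thesis by simp
    next
      case False
      have finQ: "finite Q" using less.prems fin finite_subset by blast
      have "\<exists>x\<in>Q. \<forall>y\<in>Q. key x \<le> key y"
        using finQ False by (rule ex_min_key)
      then obtain x where x: "x \<in> Q" "\<And>y. y \<in> Q \<Longrightarrow> key x \<le> key y" by blast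
      define B where "B = {q \<in> Q. q = x \<or> key x < key q \<and> R x q}"
      define Q' where "Q' = Q - B"
      have "x \<in> B" using x by (simp add: B_def)
      have "Q' \<subset> Q" using \<open>x \<in> B\<close> x by (auto simp: Q'_def)
      then have "card Q' < card Q" using finQ psubset_card_mono by blast
      moreover have "Q' \<subseteq> P" using \<open>Q' \<subset> Q\<close> less.prems by blast
      ultimately have "\<exists>\<kappa>. (\<forall>x\<in>Q'. \<kappa> x < 2 * n) \<and> (\<forall>x\<in>Q'. \<forall>y\<in>Q'. adj x y \<longrightarrow> \<kappa> x \<noteq> \<kappa> y) \<and>
          (\<forall>x\<in>Q'. \<forall>q\<in>Q'. (\<forall>y\<in>Q'. key x \<le> key y) \<and> (q = x \<or> key x < key q \<and> R x q) \<longrightarrow> \<kappa> q < n)"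
        by (rule less.hyps)
      then obtain \<mu> where \<mu>: "\<forall>x\<in>Q'. \<mu> x < 2 * n" "\<forall>x\<in>Q'. \<forall>y\<in>Q'. adj x y \<longrightarrow> \<mu> x \<noteq> \<mu> y"
         "\<forall>x\<in>Q'. \<forall>q\<in>Q'. (\<forall>y\<in>Q'. key x \<le> key y) \<and> (q = x \<or> key x < key q \<and> R x q) \<longrightarrow> \<mu> q < n"
        by (elim exE conjE)
      have "colourable adj B n"
        by (rule colourable_mono[OF block[of x]]) (use x less.prems in \<open>auto simp: B_def\<close>)
      then obtain \<beta> where \<beta>: "\<forall>x\<in>B. \<beta> x < n" "\<forall>x\<in>B. \<forall>y\<in>B. adj x y \<longrightarrow> \<beta> x \<noteq> \<beta> y"
        unfolding colourable_def by blast
      define \<kappa> where "\<kappa> q = (if q \<in> B then \<beta> q else if \<mu> q < n then \<mu> q + n else \<mu> q - n)" for q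
      have cross: "\<kappa> p \<noteq> \<kappa> q" if pq: "p \<in> B" "q \<in> Q'" "adj p q" for p q
      proof -
        have in_P: "p \<in> P" "q \<in> P" "x \<in> P" "p \<in> Q" "q \<in> Q" "q \<notin> B"
          using pq x less.prems by (auto simp: B_def Q'_def)
        have below: "key b < key q'" if "b \<in> B" "q' \<in> Q'" for b q'
        proof (rule ccontr)
          assume "\<not> key b < key q'"
          then have le: "key q' \<le> key b" by simp
          have q': "q' \<in> Q" "q' \<notin> B" "q' \<in> P" "q' \<noteq> x" "b \<in> P"
            using that \<open>x \<in> B\<close> less.prems by (auto simp: Q'_def B_def)
          have "key x < key q'"
            using x(2)[of q'] q' inj_onD[OF inj, of x q'] in_P(3) by fastforce
          moreover from this le have "b \<noteq> x" by auto
          ultimately have "R x q'"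
            using mono2[of x b q'] that(1) le q' in_P(3) by (auto simp: B_def)
          then show False using q' \<open>key x < key q'\<close> by (simp add: B_def)
        qed
        have "key p < key q" using below pq by blast
        then have "R p q" using edge in_P pq by blast
        have "finite Q'" "Q' \<noteq> {}" using finQ pq by (auto simp: Q'_def)
        then have "\<exists>x\<in>Q'. \<forall>y\<in>Q'. key x \<le> key y"
          by (rule ex_min_key)
        then obtain z where z: "z \<in> Q'" "\<forall>y\<in>Q'. key z \<le> key y" by blast
        have "z \<in> P" using z less.prems by (auto simp: Q'_def)
        have "q = z \<or> key z < key q \<and> R z q"
        proof (cases "q = z")
          case False
          then have "key z < key q"
            using z pq(2) inj_onD[OF inj, of z q] \<open>z \<in> P\<close> in_P(2) by fastforce
          moreover have "key p \<le> key z" using below[OF pq(1) z(1)] by simp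
          ultimately show ?thesis using mono1[of p z q] \<open>R p q\<close> in_P \<open>z \<in> P\<close> by blast
        qed simp
        then have "\<mu> q < n" using \<mu>(3)[rule_format, of z q] z pq by blast
        moreover have "\<beta> p < n" using \<beta>(1) pq by blast
        ultimately show ?thesis using pq in_P by (simp add: \<kappa>_def)
      qed
      have "\<kappa> y < 2 * n" if "y \<in> Q" for y
      proof (cases "y \<in> B")
        case True
        then have "\<beta> y < n" using \<beta>(1) by blast
        then show ?thesis using True by (simp add: \<kappa>_def)
      next
        case False
        then have "\<mu> y < 2 * n" using \<mu>(1) that by (simp add: Q'_def)
        then show ?thesis using False by (auto simp: \<kappa>_def)
      qed
      moreover have "\<kappa> p \<noteq> \<kappa> q" if pq: "p \<in> Q" "q \<in> Q" "adj p q" for p q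
      proof -
        consider "p \<in> B" "q \<in> B" | "p \<in> B" "q \<in> Q'" | "p \<in> Q'" "q \<in> B" | "p \<in> Q'" "q \<in> Q'"
          using pq by (auto simp: Q'_def)
        then show ?thesis
        proof cases
          case 1
          then show ?thesis using \<beta>(2) pq by (simp add: \<kappa>_def)
        next
          case 2
          then show ?thesis using cross pq by blast
        next
          case 3
          then show ?thesis using cross[of q p] pq sym by metis
        next
          case 4
          then have "\<mu> p \<noteq> \<mu> q" "\<mu> p < 2 * n" "\<mu> q < 2 * n" "p \<notin> B" "q \<notin> B"
            using \<mu>(1,2) pq by (auto simp: Q'_def)
          then show ?thesis by (auto simp: \<kappa>_def)
        qed
      qed
      moreover have "\<kappa> q < n"
        if "x' \<in> Q" "q \<in> Q" "\<forall>y\<in>Q. key x' \<le> key y" "q = x' \<or> key x' < key q \<and> R x' q" for x' q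
      proof -
        have "key x' = key x" using x that by (meson order_antisym)
        then have "x' = x" using inj_onD[OF inj, of x' x] x(1) that(1) less.prems by blast
        then have "q \<in> B" using that by (auto simp: B_def)
        then show ?thesis using \<beta>(1) by (simp add: \<kappa>_def)
      qed
      ultimately show ?thesis by blast
    qed
  qed
  show ?thesis using main[of P] unfolding colourable_def by blast
qed

section \<open>Breadth-first layers\<close>

definition component :: "('a \<Rightarrow> 'a \<Rightarrow> bool) \<Rightarrow> 'a set \<Rightarrow> 'a \<Rightarrow> 'a set" where
  "component adj X x = {z. (x, z) \<in> {(a, b). a \<in> X \<and> b \<in> X \<and> adj a b}\<^sup>*}"

definition layer :: "('a \<Rightarrow> 'a \<Rightarrow> bool) \<Rightarrow> 'a set \<Rightarrow> 'a \<Rightarrow> nat \<Rightarrow> 'a set" where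
  "layer adj X x d =
     {z. (x, z) \<in> {(a, b). a \<in> X \<and> b \<in> X \<and> adj a b} ^^ d \<and>
         (\<forall>e<d. (x, z) \<notin> {(a, b). a \<in> X \<and> b \<in> X \<and> adj a b} ^^ e)}"

lemma layer_subset: "x \<in> X \<Longrightarrow> layer adj X x d \<subseteq> X"
  by (cases d) (auto simp: layer_def)

lemma layer_subset_component: "layer adj X x d \<subseteq> component adj X x"
  by (auto simp: layer_def component_def relpow_imp_rtrancl)

lemma layer_0: "layer adj X x 0 = {x}"
  by (auto simp: layer_def)

lemma component_layer:
  assumes "z \<in> component adj X x"
  obtains d where "z \<in> layer adj X x d"
proof -
  let ?E = "{(a, b). a \<in> X \<and> b \<in> X \<and> adj a b}"
  have "\<exists>d. (x, z) \<in> ?E ^^ d"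
    using assms rtrancl_imp_relpow unfolding component_def by blast
  then have "z \<in> layer adj X x (LEAST d. (x, z) \<in> ?E ^^ d)"
    unfolding layer_def by (auto intro: LeastI_ex dest: not_less_Least)
  then show ?thesis using that by blast
qed

lemma layer_unique: "z \<in> layer adj X x d \<Longrightarrow> z \<in> layer adj X x e \<Longrightarrow> d = e"
  unfolding layer_def by (metis (mono_tags, lifting) linorder_neqE_nat mem_Collect_eq)

lemma layer_adj_le:
  assumes "a \<in> layer adj X x d" "b \<in> layer adj X x e" "a \<in> X" "b \<in> X" "adj a b"
  shows "e \<le> Suc d"
proof (rule ccontr)
  assume "\<not> e \<le> Suc d"
  moreover have "(x, b) \<in> {(a, b). a \<in> X \<and> b \<in> X \<and> adj a b} ^^ Suc d"
    using assms by (auto simp: layer_def)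
  ultimately show False using assms(2) by (auto simp: layer_def simp del: relpow.simps)
qed

lemma layer_parent:
  assumes "z \<in> layer adj X x (Suc d)"
  obtains w where "w \<in> layer adj X x d" "w \<in> X" "adj w z"
proof -
  let ?E = "{(a, b). a \<in> X \<and> b \<in> X \<and> adj a b}"
  from assms obtain w where w: "(x, w) \<in> ?E ^^ d" "(w, z) \<in> ?E"
    by (auto simp: layer_def)
  have "(x, w) \<notin> ?E ^^ e" if "e < d" for e
  proof
    assume "(x, w) \<in> ?E ^^ e"
    then have "(x, z) \<in> ?E ^^ Suc e" using w(2) by auto
    moreover have "(x, z) \<notin> ?E ^^ Suc e"
      using assms that unfolding layer_def by blast
    ultimately show False by contradiction
  qed
  with w show ?thesis by (intro that[of w]) (auto simp: layer_def)
qed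

text \<open>Layers at distance at least two from each other are not joined by edges, so two palettes
  suffice for each component; the root of a component may be chosen as its first element.\<close>

lemma colourable_layers:
  fixes key :: "'a \<Rightarrow> real"
  assumes fin: "finite X" and sym: "\<And>x y. adj x y \<Longrightarrow> adj y x"
    and layers: "\<And>x d. x \<in> X \<Longrightarrow> \<forall>z \<in> component adj X x. key x \<le> key z \<Longrightarrow>
                   colourable adj (layer adj X x d) n"
    and inj: "inj_on key X"
  shows "colourable adj X (2 * n)"
proof -
  let ?E = "{(a, b). a \<in> X \<and> b \<in> X \<and> adj a b}"
  have symE: "sym (?E\<^sup>*)" using sym by (intro sym_rtrancl) (auto simp: sym_def)
  have comp_X: "component adj X x \<subseteq> X" if "x \<in> X" for x
  proof
    fix z assume "z \<in> component adj X x"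
    then show "z \<in> X" using that layer_subset component_layer by (metis subsetD)
  qed
  have self: "x \<in> component adj X x" for x by (simp add: component_def)
  have comp_eq: "component adj X x = component adj X y" if "y \<in> component adj X x" for x y
    using that symE unfolding component_def by (auto dest: symD intro: rtrancl_trans)
  define root where "root x = arg_min_on key (component adj X x)" for x
  have root: "root x \<in> component adj X x" "\<forall>z \<in> component adj X x. key (root x) \<le> key z" "root x \<in> X"
    if "x \<in> X" for x
  proof -
    have "finite (component adj X x)" "component adj X x \<noteq> {}"
      using comp_X[OF that] fin self[of x] finite_subset by blast+
    then show "root x \<in> component adj X x" "\<forall>z \<in> component adj X x. key (root x) \<le> key z"
      unfolding root_def by (auto intro: arg_min_if_finite(1) arg_min_least)
    then show "root x \<in> X" using comp_X[OF that] by blast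
  qed
  define good where "good x d \<kappa> \<longleftrightarrow> (\<forall>z\<in>layer adj X x d. \<kappa> z < n) \<and>
      (\<forall>z\<in>layer adj X x d. \<forall>w\<in>layer adj X x d. adj z w \<longrightarrow> \<kappa> z \<noteq> \<kappa> w)" for x d and \<kappa> :: "'a \<Rightarrow> nat"
  define K where "K x d = (SOME \<kappa>. good x d \<kappa>)" for x d
  have K: "good (root x) d (K (root x) d)" if "x \<in> X" for x d
  proof -
    have "colourable adj (layer adj X (root x) d) n"
      using layers[of "root x" d] root[OF that] comp_eq[OF root(1)[OF that]] by simp
    then have "\<exists>\<kappa>. good (root x) d \<kappa>" by (simp add: colourable_def good_def)
    then show ?thesis unfolding K_def by (rule someI_ex)
  qed
  define dist where "dist x = (SOME d. x \<in> layer adj X (root x) d)" for x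
  have dist: "x \<in> layer adj X (root x) (dist x)" if "x \<in> X" for x
  proof -
    have "x \<in> component adj X (root x)"
      using root(1)[OF that] comp_eq self by blast
    then show ?thesis unfolding dist_def by (metis component_layer someI_ex)
  qed
  have root_eq: "root x = root y" if "x \<in> X" "y \<in> X" "adj x y" for x y
  proof -
    have "y \<in> component adj X x" using that by (auto simp: component_def)
    then have "component adj X x = component adj X y" by (rule comp_eq)
    then show ?thesis by (simp add: root_def)
  qed
  define \<kappa> where "\<kappa> x = K (root x) (dist x) x + (if even (dist x) then 0 else n)" for x
  have lt: "K (root x) (dist x) x < n" if "x \<in> X" for x
    using K[OF that] dist[OF that] by (simp add: good_def)
  have "\<kappa> x \<noteq> \<kappa> y" if xy: "x \<in> X" "y \<in> X" "adj x y" for x y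
  proof (cases "dist x = dist y")
    case True
    then have "K (root x) (dist x) x \<noteq> K (root x) (dist x) y"
      using K[OF xy(1), of "dist x"] dist[OF xy(1)] dist[OF xy(2)] xy(3) root_eq[OF xy]
      by (auto simp: good_def)
    then show ?thesis using True root_eq[OF xy] by (simp add: \<kappa>_def)
  next
    case False
    moreover have "dist y \<le> Suc (dist x)" "dist x \<le> Suc (dist y)"
      using layer_adj_le[OF dist[OF xy(1)] _ xy(1,2,3)] layer_adj_le[OF dist[OF xy(2)] _ xy(2,1)]
        dist[OF xy(1)] dist[OF xy(2)] root_eq[OF xy] sym[OF xy(3)] by auto
    ultimately have "even (dist x) \<longleftrightarrow> odd (dist y)" by (metis even_Suc le_SucE le_antisym)
    then show ?thesis using lt[OF xy(1)] lt[OF xy(2)] by (auto simp: \<kappa>_def)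
  qed
  moreover have "\<kappa> x < 2 * n" if "x \<in> X" for x
    using lt[OF that] by (auto simp: \<kappa>_def)
  ultimately show ?thesis unfolding colourable_def by blast
qed

section \<open>Grounded families\<close>

text \<open>Vertex \<open>i\<close> stands for the graph of \<open>f i\<close> over \<open>{t0..r i}\<close>. No continuity is needed: a curve that has
  crossed a curve starting above it stays above it.\<close>

locale grounded =
  fixes V :: "'a set" and t0 :: real and f :: "'a \<Rightarrow> real \<Rightarrow> real" and r :: "'a \<Rightarrow> real"
    and adj :: "'a \<Rightarrow> 'a \<Rightarrow> bool"
  assumes fin: "finite V"
    and inj: "inj_on (\<lambda>i. f i t0) V"
    and start: "i \<in> V \<Longrightarrow> t0 \<le> r i"
    and irr: "\<not> adj i i"
    and sym: "adj i j \<Longrightarrow> adj j i"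
    and cross: "i \<in> V \<Longrightarrow> j \<in> V \<Longrightarrow> f i t0 < f j t0 \<Longrightarrow>
                  adj i j \<longleftrightarrow> f j (min (r i) (r j)) \<le> f i (min (r i) (r j))"
    and once: "i \<in> V \<Longrightarrow> j \<in> V \<Longrightarrow> f i t0 < f j t0 \<Longrightarrow> t0 \<le> x \<Longrightarrow> x \<le> x' \<Longrightarrow> x' \<le> r i \<Longrightarrow>
                  x' \<le> r j \<Longrightarrow> f j x \<le> f i x \<Longrightarrow> f j x' \<le> f i x'"
begin

abbreviation key :: "'a \<Rightarrow> real" where "key i \<equiv> f i t0"

lemma mirror: "grounded V t0 (\<lambda>i x. - f i x) r adj"
proof
  show "inj_on (\<lambda>i. - f i t0) V" using inj by (auto simp: inj_on_def)
  show "adj i j \<longleftrightarrow> - f j (min (r i) (r j)) \<le> - f i (min (r i) (r j))"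
    if "i \<in> V" "j \<in> V" "- f i t0 < - f j t0" for i j
    using cross[of j i] that sym by (auto simp: min.commute)
  show "- f j x' \<le> - f i x'"
    if "i \<in> V" "j \<in> V" "- f i t0 < - f j t0" "t0 \<le> x" "x \<le> x'" "x' \<le> r i" "x' \<le> r j" "- f j x \<le> - f i x"
    for i j x x'
    using once[of j i x x'] that by simp
qed (use fin start irr sym in auto)

lemma not_adj_above:
  assumes "i \<in> V" "j \<in> V" "key i < key j" "\<not> adj i j" "t0 \<le> x" "x \<le> r i" "x \<le> r j"
  shows "f i x < f j x"
proof (rule ccontr)
  assume "\<not> f i x < f j x"
  then have "f j (min (r i) (r j)) \<le> f i (min (r i) (r j))"
    using once[of i j x "min (r i) (r j)"] assms by simp
  then show False using cross[of i j] assms by simp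
qed

lemma adj_flip:
  assumes "i \<in> V" "j \<in> V" "key i < key j" "t0 \<le> x" "x \<le> r i" "x \<le> r j" "f j x \<le> f i x"
  shows "adj i j"
  using not_adj_above[OF assms(1-3) _ assms(4-6)] assms(7) by fastforce

lemma between:
  assumes "i \<in> V" "j \<in> V" "k \<in> V" "key i < key j" "key j < key k" "adj i k"
    and "\<not> adj i j" "\<not> adj j k"
  shows "r j < r i" "r j < r k"
proof -
  have "r j < min (r i) (r k)"
  proof (rule ccontr)
    let ?m = "min (r i) (r k)"
    assume "\<not> r j < ?m"
    moreover have "t0 \<le> ?m" using start assms by simp
    ultimately have "f i ?m < f j ?m" "f j ?m < f k ?m"
      using not_adj_above[of i j ?m] not_adj_above[of j k ?m] assms by auto
    moreover have "f k ?m \<le> f i ?m" using cross[of i k] assms by auto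
    ultimately show False by simp
  qed
  then show "r j < r i" "r j < r k" by auto
qed

end

section \<open>Levels of supports\<close>

text \<open>The supports of level \<open>a\<close> are \<open>S a\<close>; their common neighbour \<open>q\<close> provides a colouring of all of them.\<close>

definition nested_left :: "('a \<Rightarrow> 'a \<Rightarrow> bool) \<Rightarrow> ('a \<Rightarrow> real) \<Rightarrow> 'a set \<Rightarrow> nat \<Rightarrow> 'a set \<Rightarrow> bool" where
  "nested_left adj key V n X \<longleftrightarrow>
     (\<exists>q S. \<forall>a<n. q \<in> V \<and> S a \<subseteq> V \<and> (\<forall>x\<in>X. \<exists>s\<in>S a. adj s x \<and> adj s q) \<and>
        (\<forall>s\<in>S a. (\<forall>x\<in>X. key s < key x) \<and> (\<forall>b<n. a < b \<longrightarrow> (\<forall>h\<in>S b. key s < key h))))"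

lemma nested_left_0: "nested_left adj key V 0 X"
  by (simp add: nested_left_def)

lemma nested_left_mono:
  assumes "nested_left adj key V n X" "Y \<subseteq> X" "m \<le> n"
  shows "nested_left adj key V m Y"
proof -
  obtain q S where S: "\<And>a. a < n \<Longrightarrow> q \<in> V \<and> S a \<subseteq> V \<and> (\<forall>x\<in>X. \<exists>s\<in>S a. adj s x \<and> adj s q) \<and>
        (\<forall>s\<in>S a. (\<forall>x\<in>X. key s < key x) \<and> (\<forall>b<n. a < b \<longrightarrow> (\<forall>h\<in>S b. key s < key h)))"
    using assms(1) unfolding nested_left_def by blast
  have "q \<in> V \<and> S a \<subseteq> V \<and> (\<forall>x\<in>Y. \<exists>s\<in>S a. adj s x \<and> adj s q) \<and>
        (\<forall>s\<in>S a. (\<forall>x\<in>Y. key s < key x) \<and> (\<forall>b<m. a < b \<longrightarrow> (\<forall>h\<in>S b. key s < key h)))"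
    if "a < m" for a
  proof -
    have "a < n" using that assms(3) by simp
    then show ?thesis using S[of a] assms(2,3) by (meson less_le_trans subsetD)
  qed
  then show ?thesis unfolding nested_left_def by blast
qed

context grounded
begin

lemma nested_left_step:
  assumes lvl: "nested_left adj key V n X" and sub: "Y \<subseteq> X" "T \<subseteq> X" "X \<subseteq> V" "u \<in> X"
    and Y: "\<And>p. p \<in> Y \<Longrightarrow> key u < key p \<and> \<not> adj u p \<and> r p < r u \<and> (\<exists>s\<in>T. key s < key u \<and> adj s p)"
  shows "nested_left adj key V (Suc n) Y"
proof -
  obtain q S where S: "\<And>a. a < n \<Longrightarrow> q \<in> V \<and> S a \<subseteq> V \<and> (\<forall>x\<in>X. \<exists>s\<in>S a. adj s x \<and> adj s q) \<and>
        (\<forall>s\<in>S a. (\<forall>x\<in>X. key s < key x) \<and> (\<forall>b<n. a < b \<longrightarrow> (\<forall>h\<in>S b. key s < key h)))"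
    using lvl unfolding nested_left_def by blast
  have touch: "adj s u" if "s \<in> V" "p \<in> Y" "key s < key u" "adj s p" for s p
    using between[of s u p] Y[of p] that sub by (meson less_asym subsetD)
  define S' where "S' a = (if a = n then {s \<in> T. key s < key u} else S a)" for a
  have "u \<in> V \<and> S' a \<subseteq> V \<and> (\<forall>x\<in>Y. \<exists>s\<in>S' a. adj s x \<and> adj s u) \<and>
        (\<forall>s\<in>S' a. (\<forall>x\<in>Y. key s < key x) \<and> (\<forall>b<Suc n. a < b \<longrightarrow> (\<forall>h\<in>S' b. key s < key h)))"
    if a: "a < Suc n" for a
  proof (cases "a = n")
    case True
    have "\<exists>s\<in>S' a. adj s x \<and> adj s u" if "x \<in> Y" for x
      using Y[OF that] touch[OF _ that] sub True by (auto simp: S'_def) blast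
    then show ?thesis using True sub Y by (fastforce simp: S'_def)
  next
    case False
    then have "a < n" using a by simp
    have "\<exists>s\<in>S' a. adj s x \<and> adj s u" if "x \<in> Y" for x
      using S[OF \<open>a < n\<close>] touch[OF _ that] sub that False unfolding S'_def by (metis subsetD)
    moreover have "key s < key h" if "s \<in> S' a" "b < Suc n" "a < b" "h \<in> S' b" for s b h
      using S[OF \<open>a < n\<close>] that sub False by (cases "b = n") (auto simp: S'_def less_Suc_eq)
    moreover have "u \<in> V" "S' a \<subseteq> V" "\<forall>s\<in>S' a. \<forall>x\<in>Y. key s < key x"
      using S[OF \<open>a < n\<close>] sub False by (auto simp: S'_def)
    ultimately show ?thesis by blast
  qed
  then show ?thesis unfolding nested_left_def by blast
qed

text \<open>Colour the neighbours of \<open>q\<close>. Each vertex has two supports \<open>s\<close>, \<open>h\<close> of the same colour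
  from different levels; if \<open>h\<close> supports the last vertex \<open>p\<close>, then every other vertex is
  adjacent to \<open>h\<close> or to \<open>p\<close>, since it would otherwise be both shorter and longer than \<open>h\<close>.\<close>

lemma nested_left_colourable:
  assumes nb: "\<And>v. v \<in> V \<Longrightarrow> colourable adj {x \<in> V. adj v x} c"
    and lvl: "nested_left adj key V (Suc c) X" and X: "X \<subseteq> V"
  shows "colourable adj X (Suc c * Suc c * c * (2 * c + 1))"
proof -
  obtain q S where S: "\<And>a. a \<le> c \<Longrightarrow> q \<in> V \<and> S a \<subseteq> V \<and> (\<forall>x\<in>X. \<exists>s\<in>S a. adj s x \<and> adj s q) \<and>
        (\<forall>s\<in>S a. (\<forall>x\<in>X. key s < key x) \<and> (\<forall>b\<le>c. a < b \<longrightarrow> (\<forall>h\<in>S b. key s < key h)))"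
    using lvl unfolding nested_left_def less_Suc_eq_le by blast
  then have q: "q \<in> V" by blast
  obtain \<kappa> where \<kappa>: "\<And>x. x \<in> V \<Longrightarrow> adj q x \<Longrightarrow> \<kappa> x < c"
      "\<And>x y. x \<in> V \<Longrightarrow> y \<in> V \<Longrightarrow> adj q x \<Longrightarrow> adj q y \<Longrightarrow> adj x y \<Longrightarrow> \<kappa> x \<noteq> \<kappa> y"
    using nb[OF q] unfolding colourable_def by auto
  define W where "W = (\<lambda>(a, b, \<alpha>). {x \<in> X. a < b \<and> (\<exists>s\<in>S a. \<exists>h\<in>S b. adj s x \<and> adj h x \<and>
      adj q s \<and> adj q h \<and> \<kappa> s = \<alpha> \<and> \<kappa> h = \<alpha>)})"
  let ?I = "{..c} \<times> {..c} \<times> {..<c}"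
  have cover: "X \<subseteq> (\<Union>i\<in>?I. W i)"
  proof
    fix x assume x: "x \<in> X"
    have "\<forall>a\<in>{..c}. \<exists>s. s \<in> S a \<and> adj s x \<and> adj q s \<and> s \<in> V"
    proof
      fix a assume "a \<in> {..c}"
      then show "\<exists>s. s \<in> S a \<and> adj s x \<and> adj q s \<and> s \<in> V"
        using S[of a] x sym by blast
    qed
    from bchoice[OF this] obtain s
      where "\<forall>a\<in>{..c}. s a \<in> S a \<and> adj (s a) x \<and> adj q (s a) \<and> s a \<in> V" ..
    then have s: "s a \<in> S a" "adj (s a) x" "adj q (s a)" "s a \<in> V" if "a \<le> c" for a
      using that by auto
    have "(\<lambda>a. \<kappa> (s a)) ` {..c} \<subseteq> {..<c}"
    proof
      fix k assume "k \<in> (\<lambda>a. \<kappa> (s a)) ` {..c}"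
      then obtain a where "a \<le> c" "k = \<kappa> (s a)" by auto
      then show "k \<in> {..<c}" using s(3,4)[of a] \<kappa>(1)[of "s a"] by simp
    qed
    from card_mono[OF _ this] have "card ((\<lambda>a. \<kappa> (s a)) ` {..c}) < card {..c}" by simp
    then have "\<not> inj_on (\<lambda>a. \<kappa> (s a)) {..c}" by (rule pigeonhole)
    then obtain a b where "a \<le> c" "b \<le> c" "a \<noteq> b" "\<kappa> (s a) = \<kappa> (s b)"
      unfolding inj_on_def by auto
    then obtain a b where "a \<le> c" "b \<le> c" "a < b" "\<kappa> (s a) = \<kappa> (s b)"
      by (metis linorder_neqE_nat)
    then have "x \<in> W (a, b, \<kappa> (s a))" "(a, b, \<kappa> (s a)) \<in> ?I"
      using s[of a] s[of b] x \<kappa>(1)[of "s a"] by (auto simp: W_def)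
    then show "x \<in> (\<Union>i\<in>?I. W i)" by blast
  qed
  have "colourable adj (W i) (2 * c + 1)" if i: "i \<in> ?I" for i
  proof (cases "W i = {}")
    case False
    obtain a b \<alpha> where [simp]: "i = (a, b, \<alpha>)" by (cases i)
    have ab: "a \<le> c" "b \<le> c" using i by auto
    have WX: "W i \<subseteq> X" by (auto simp: W_def)
    have "finite (W i)" using WX X fin finite_subset by metis
    then obtain p where p: "p \<in> W i" "\<forall>x\<in>W i. - key p \<le> - key x"
      using ex_min_key[of "W i" "\<lambda>x. - key x"] False by blast
    then obtain h where h: "h \<in> S b" "adj h p" "adj q h" "\<kappa> h = \<alpha>" "a < b"
      by (auto simp: W_def)
    have hV: "h \<in> V" "p \<in> V" "p \<in> X" using h S[OF ab(2)] p WX X by auto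
    have "W i \<subseteq> {x \<in> V. adj h x} \<union> {x \<in> V. adj p x} \<union> {p}"
    proof
      fix x assume x: "x \<in> W i"
      then obtain s where s: "s \<in> S a" "adj s x" "adj q s" "\<kappa> s = \<alpha>" by (auto simp: W_def)
      have sV: "s \<in> V" "x \<in> V" "x \<in> X" using s S[OF ab(1)] x WX X by auto
      show "x \<in> {x \<in> V. adj h x} \<union> {x \<in> V. adj p x} \<union> {p}"
      proof (rule ccontr)
        assume not: "x \<notin> {x \<in> V. adj h x} \<union> {x \<in> V. adj p x} \<union> {p}"
        have "\<not> adj s h" using \<kappa>(2)[of s h] sV hV s h by auto
        moreover have "key s < key h" using S[OF ab(1)] s(1) h ab by blast
        moreover have hx: "key h < key x" using S[OF ab(2)] h(1) sV by blast
        ultimately have "r h < r x"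
          using between[of s h x] not sV hV s by auto
        moreover have "key x < key p"
          using p x not sV hV inj_onD[OF inj, of x p] by fastforce
        then have "r x < r h"
          using between[of h x p] not sV hV h hx sym by blast
        ultimately show False by simp
      qed
    qed
    moreover have "colourable adj ({x \<in> V. adj h x} \<union> {x \<in> V. adj p x} \<union> {p}) (c + c + 1)"
      by (intro colourable_Un nb hV colourable_independent) (simp add: irr)
    ultimately show ?thesis by (metis colourable_mono mult_2 order_refl)
  qed (simp add: colourable_def)
  then have "colourable adj (\<Union>i\<in>?I. W i) (card ?I * (2 * c + 1))"
    by (intro colourable_UN) auto
  moreover have "card ?I = Suc c * Suc c * c"
    by (simp only: card_cartesian_product card_atMost card_lessThan mult.assoc)
  ultimately show ?thesis using colourable_mono[OF _ cover order_refl] by metis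
qed

end

section \<open>Levels of walls\<close>

text \<open>\<open>Y a x\<close> is the wall of level \<open>a\<close> assigned to \<open>x\<close>; together with \<open>x\<close> these walls form a clique.\<close>

definition walls_of :: "('a \<Rightarrow> 'a \<Rightarrow> bool) \<Rightarrow> ('a \<Rightarrow> real) \<Rightarrow> 'a set \<Rightarrow> nat \<Rightarrow> nat \<Rightarrow> 'a set \<Rightarrow> (nat \<Rightarrow> 'a \<Rightarrow> 'a) \<Rightarrow> bool" where
  "walls_of adj key V c n X Y \<longleftrightarrow>
     (\<forall>a<n.
        (\<forall>x\<in>X. Y a x \<in> V \<and> key x < key (Y a x) \<and> adj x (Y a x)) \<and>
        (\<forall>x\<in>X. \<forall>y\<in>X. key x \<le> key y \<longrightarrow> key (Y a x) \<le> key (Y a y)) \<and>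
        (\<forall>x\<in>X. \<forall>b<n. b \<noteq> a \<longrightarrow> adj (Y a x) (Y b x)) \<and>
        (\<forall>x\<in>X. \<forall>p\<in>X. \<forall>q\<in>X. adj p q \<and> key p < key (Y a x) \<and> key (Y a x) < key q \<longrightarrow> adj p (Y a x)) \<and>
        (\<forall>x\<in>X. colourable adj {p \<in> X. key x \<le> key p \<and> key p < key (Y a x)} (n * c)))"

definition walled :: "('a \<Rightarrow> 'a \<Rightarrow> bool) \<Rightarrow> ('a \<Rightarrow> real) \<Rightarrow> 'a set \<Rightarrow> nat \<Rightarrow> nat \<Rightarrow> 'a set \<Rightarrow> bool" where
  "walled adj key V c n X \<longleftrightarrow> (\<exists>Y. walls_of adj key V c n X Y)"

lemma walled_0: "walled adj key V c 0 X"
  by (simp add: walled_def walls_of_def)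

lemma walled_subset:
  assumes "walled adj key V c n X" "Z \<subseteq> X"
  shows "walled adj key V c n Z"
proof -
  obtain Y where Y: "walls_of adj key V c n X Y"
    using assms(1) unfolding walled_def by blast
  note Y = Y[unfolded walls_of_def, THEN spec, THEN mp]
  have Z: "z \<in> X" if "z \<in> Z" for z using that assms(2) by blast
  show ?thesis
    unfolding walled_def walls_of_def
  proof (intro exI[of _ Y] allI impI conjI ballI)
    fix a x assume a: "a < n" and x: "x \<in> Z"
    note Ya = Y[OF a]
    show "Y a x \<in> V" "key x < key (Y a x)" "adj x (Y a x)" using Ya Z[OF x] by auto
    show "key (Y a x) \<le> key (Y a y)" if "y \<in> Z" "key x \<le> key y" for y
      using Ya Z[OF x] Z[OF that(1)] that(2) by auto
    show "adj (Y a x) (Y b x)" if "b < n" "b \<noteq> a" for b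
      using Ya Z[OF x] that by auto
    show "adj p (Y a x)"
      if "p \<in> Z" "q \<in> Z" "adj p q \<and> key p < key (Y a x) \<and> key (Y a x) < key q" for p q
      using Ya Z[OF x] Z[OF that(1)] Z[OF that(2)] that(3) by blast
    have "colourable adj {p \<in> X. key x \<le> key p \<and> key p < key (Y a x)} (n * c)"
      using Ya Z[OF x] by auto
    then show "colourable adj {p \<in> Z. key x \<le> key p \<and> key p < key (Y a x)} (n * c)"
      by (rule colourable_mono) (use Z in auto)
  qed
qed

lemma walled_empty:
  assumes irr: "\<And>x. \<not> adj x x" and sym: "\<And>x y. adj x y \<Longrightarrow> adj y x"
    and cl: "\<And>K. K \<subseteq> V \<Longrightarrow> finite K \<Longrightarrow> \<forall>x\<in>K. \<forall>y\<in>K. x \<noteq> y \<longrightarrow> adj x y \<Longrightarrow> card K \<le> n"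
    and w: "walled adj key V c n X" and X: "X \<subseteq> V"
  shows "X = {}"
proof (rule ccontr)
  assume "X \<noteq> {}"
  then obtain x where x: "x \<in> X" by blast
  obtain Y where Y: "\<And>a. a < n \<Longrightarrow> Y a \<in> V \<and> adj x (Y a)"
      "\<And>a b. a < n \<Longrightarrow> b < n \<Longrightarrow> b \<noteq> a \<Longrightarrow> adj (Y a) (Y b)"
  proof -
    from w obtain Y where "walls_of adj key V c n X Y" unfolding walled_def by blast
    then show ?thesis using x by (intro that[of "\<lambda>a. Y a x"]) (auto simp: walls_of_def)
  qed
  have "inj_on Y {..<n}" using Y(2) irr by (metis inj_onI lessThan_iff)
  moreover have "x \<notin> Y ` {..<n}" using Y(1) irr by auto
  ultimately have "card (insert x (Y ` {..<n})) = Suc n" by (simp add: card_image)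
  moreover have "card (insert x (Y ` {..<n})) \<le> n"
    using Y sym x X by (intro cl) auto
  ultimately show False by simp
qed

text \<open>The new walls \<open>S\<close> lie in \<open>X\<close>, so each of them has already a clique of older walls attached
  to it. A vertex is attached to the first wall \<open>\<sigma> z\<close> behind it and to the clique of \<open>\<sigma> z\<close>; the
  vertices not adjacent to a member of that clique cannot have neighbours behind this
  member, and form sets to which \<open>colourable_blocks\<close> applies.\<close>

lemma walled_step:
  assumes finV: "finite V" and inj: "inj_on key V"
    and irr: "\<And>x. \<not> adj x x" and sym: "\<And>x y. adj x y \<Longrightarrow> adj y x"
    and nb: "\<And>v. v \<in> V \<Longrightarrow> colourable adj {x \<in> V. adj v x} c"
    and w: "walled adj key V c n X" and sub: "X \<subseteq> V" "Z \<subseteq> X" "S \<subseteq> X"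
    and succ: "\<And>z. z \<in> Z \<Longrightarrow> \<exists>s\<in>S. key z < key s"
    and succ_adj: "\<And>z s. z \<in> Z \<Longrightarrow> s \<in> S \<Longrightarrow> key z < key s \<Longrightarrow>
          \<forall>s'\<in>S. key z < key s' \<longrightarrow> key s \<le> key s' \<Longrightarrow> adj z s"
    and wall: "\<And>p q s. p \<in> Z \<Longrightarrow> q \<in> Z \<Longrightarrow> s \<in> S \<Longrightarrow> adj p q \<Longrightarrow> key p < key s \<Longrightarrow> key s < key q \<Longrightarrow> adj p s"
    and cont: "\<And>Z'. Z' \<subseteq> Z \<Longrightarrow> walled adj key V c (Suc n) Z' \<Longrightarrow> colourable adj Z' m"
  shows "colourable adj Z (m + n * (2 * (Suc n * c)))"
proof -
  obtain Y where "walls_of adj key V c n X Y"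
    using w unfolding walled_def by blast
  note Y = this[unfolded walls_of_def, THEN spec, THEN mp]
  have Y1: "Y a x \<in> V" "key x < key (Y a x)" "adj x (Y a x)" if "a < n" "x \<in> X" for a x
    using Y[OF that(1)] that(2) by auto
  have Y2: "key (Y a x) \<le> key (Y a y)" if "a < n" "x \<in> X" "y \<in> X" "key x \<le> key y" for a x y
    using Y[OF that(1)] that(2-) by auto
  have Y3: "adj (Y a x) (Y b x)" if "a < n" "x \<in> X" "b < n" "b \<noteq> a" for a b x
    using Y[OF that(1)] that(2-) by auto
  have Y4: "adj p (Y a x)"
    if "a < n" "x \<in> X" "p \<in> X" "q \<in> X" "adj p q" "key p < key (Y a x)" "key (Y a x) < key q" for a x p q
    using Y[OF that(1)] that(2-) by blast
  have Y5: "colourable adj {p \<in> X. key x \<le> key p \<and> key p < key (Y a x)} (n * c)" if "a < n" "x \<in> X" for a x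
    using Y[OF that(1)] that(2-) by auto
  define \<sigma> where "\<sigma> z = arg_min_on key {s \<in> S. key z < key s}" for z
  have "finite S" using sub finV finite_subset by metis
  have \<sigma>: "\<sigma> z \<in> S" "key z < key (\<sigma> z)" "\<And>s. s \<in> S \<Longrightarrow> key z < key s \<Longrightarrow> key (\<sigma> z) \<le> key s"
    if "z \<in> Z" for z
  proof -
    have fs: "finite {s \<in> S. key z < key s}" using \<open>finite S\<close> by simp
    have ne: "{s \<in> S. key z < key s} \<noteq> {}" using succ[OF that] by blast
    show "\<sigma> z \<in> S" "key z < key (\<sigma> z)"
      using arg_min_if_finite(1)[OF fs ne, of key] by (auto simp: \<sigma>_def)
    show "key (\<sigma> z) \<le> key s" if "s \<in> S" "key z < key s" for s
      using arg_min_least[OF fs ne, of s key] that by (auto simp: \<sigma>_def)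
  qed
  have \<sigma>X: "\<sigma> z \<in> X" "\<sigma> z \<in> V" if "z \<in> Z" for z using \<sigma>(1)[OF that] sub by auto
  have \<sigma>_mono: "key (\<sigma> x) \<le> key (\<sigma> y)" if "x \<in> Z" "y \<in> Z" "key x \<le> key y" for x y
    using \<sigma>[OF that(1)] \<sigma>[OF that(2)] that(3) by force
  have \<sigma>_adj: "adj z (\<sigma> z)" if "z \<in> Z" for z
    using \<sigma>[OF that] by (intro succ_adj that) auto
  have near: "colourable adj {p \<in> Z. key x \<le> key p \<and> key p < key (\<sigma> x)} c" if "x \<in> Z" for x
  proof (rule colourable_mono[OF nb])
    show "{p \<in> Z. key x \<le> key p \<and> key p < key (\<sigma> x)} \<subseteq> {p \<in> V. adj (\<sigma> x) p}"
    proof clarify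
      fix p assume p: "p \<in> Z" "key x \<le> key p" "key p < key (\<sigma> x)"
      then have "key (\<sigma> p) = key (\<sigma> x)"
        using \<sigma>(3)[OF p(1) \<sigma>(1)[OF that]] \<sigma>_mono[OF that p(1,2)] by simp
      then have "\<sigma> p = \<sigma> x"
        using \<sigma>X[OF p(1)] \<sigma>X[OF that] inj_onD[OF inj, of "\<sigma> p" "\<sigma> x"] by blast
      then show "p \<in> V \<and> adj (\<sigma> x) p" using \<sigma>_adj[OF p(1)] sym p sub by auto
    qed
  qed (use \<sigma>X that in auto)
  have far: "colourable adj {p \<in> Z. key x \<le> key p \<and> key p < key (Y a (\<sigma> x))} (Suc n * c)"
    if "a < n" "x \<in> Z" for a x
  proof -
    have "colourable adj ({p \<in> Z. key x \<le> key p \<and> key p < key (\<sigma> x)} \<union>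
        {p \<in> X. key (\<sigma> x) \<le> key p \<and> key p < key (Y a (\<sigma> x))}) (c + n * c)"
      using near[OF that(2)] Y5[OF that(1) \<sigma>X(1)[OF that(2)]] by (rule colourable_Un)
    then show ?thesis
      by (rule colourable_mono) (use sub in auto)
  qed
  define bad where "bad a = {z \<in> Z. \<not> adj z (Y a (\<sigma> z))}" for a
  have bad: "colourable adj (bad a) (2 * (Suc n * c))" if a: "a < n" for a
  proof (rule colourable_blocks[where key = key and R = "\<lambda>p q. key q < key (Y a (\<sigma> p))"])
    have badZ: "bad a \<subseteq> Z" by (auto simp: bad_def)
    show "finite (bad a)" using badZ sub finV finite_subset by metis
    show "inj_on key (bad a)" using badZ sub inj inj_on_subset by metis
    show "key q < key (Y a (\<sigma> p))"
      if pq: "p \<in> bad a" "q \<in> bad a" "key p < key q" "adj p q" for p q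
    proof (rule ccontr)
      assume not: "\<not> key q < key (Y a (\<sigma> p))"
      have pZ: "p \<in> Z" "q \<in> Z" "p \<in> X" "q \<in> X" "q \<in> V" using pq sub badZ by auto
      have "key p < key (Y a (\<sigma> p))"
        using \<sigma>(2)[OF pZ(1)] Y1(2)[OF a \<sigma>X(1)[OF pZ(1)]] by simp
      moreover have "Y a (\<sigma> p) \<noteq> q" using pq by (auto simp: bad_def)
      then have "key (Y a (\<sigma> p)) < key q"
        using not inj_onD[OF inj, of "Y a (\<sigma> p)" q] Y1(1)[OF a \<sigma>X(1)[OF pZ(1)]] pZ by fastforce
      ultimately have "adj p (Y a (\<sigma> p))"
        using Y4[OF a \<sigma>X(1)[OF pZ(1)] pZ(3,4) pq(4)] by blast
      then show False using pq(1) by (simp add: bad_def)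
    qed
    show "key q < key (Y a (\<sigma> p'))"
      if "p \<in> bad a" "p' \<in> bad a" "q \<in> bad a" "key p \<le> key p'" "key p' < key q" "key q < key (Y a (\<sigma> p))"
      for p p' q
    proof -
      have pZ: "p \<in> Z" "p' \<in> Z" using that badZ by auto
      show ?thesis
        using Y2[OF a \<sigma>X(1)[OF pZ(1)] \<sigma>X(1)[OF pZ(2)] \<sigma>_mono[OF pZ that(4)]] that by simp
    qed
    show "key q' < key (Y a (\<sigma> p))"
      if "key q' \<le> key q" "key q < key (Y a (\<sigma> p))" for p q q' using that by simp
    show "colourable adj {q \<in> bad a. q = x \<or> key x < key q \<and> key q < key (Y a (\<sigma> x))} (Suc n * c)"
      if "x \<in> bad a" for x
    proof (rule colourable_mono[OF far[OF a]])
      show xZ: "x \<in> Z" using that badZ by auto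
      have "key x < key (Y a (\<sigma> x))"
        using \<sigma>(2)[OF xZ] Y1(2)[OF a \<sigma>X(1)[OF xZ]] by simp
      then show "{q \<in> bad a. q = x \<or> key x < key q \<and> key q < key (Y a (\<sigma> x))}
          \<subseteq> {p \<in> Z. key x \<le> key p \<and> key p < key (Y a (\<sigma> x))}" using badZ by auto
    qed simp
  qed (use irr sym in auto)
  define Z' where "Z' = Z - (\<Union>a\<in>{..<n}. bad a)"
  have Z'Z: "Z' \<subseteq> Z" by (auto simp: Z'_def)
  define Y' where "Y' a z = (if a = n then \<sigma> z else Y a (\<sigma> z))" for a z
  have good: "adj z (Y a (\<sigma> z))" if "z \<in> Z'" "a < n" for a z
    using that by (auto simp: Z'_def bad_def)
  have "walled adj key V c (Suc n) Z'"
    unfolding walled_def walls_of_def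
  proof (intro exI[of _ Y'] allI impI conjI ballI)
    fix a x assume a: "a < Suc n" and x: "x \<in> Z'"
    have xZ: "x \<in> Z" using x Z'Z by auto
    have a': "a < n" if "a \<noteq> n" using that a by simp
    show "Y' a x \<in> V" using \<sigma>X[OF xZ] Y1(1) a' by (simp add: Y'_def)
    show "key x < key (Y' a x)"
      using \<sigma>(2)[OF xZ] Y1(2)[OF a' \<sigma>X(1)[OF xZ]] by (auto simp: Y'_def)
    show "adj x (Y' a x)" using \<sigma>_adj[OF xZ] good[OF x a'] by (auto simp: Y'_def)
    show "key (Y' a x) \<le> key (Y' a y)" if "y \<in> Z'" "key x \<le> key y" for y
    proof -
      have yZ: "y \<in> Z" using that Z'Z by auto
      show ?thesis
        using \<sigma>_mono[OF xZ yZ that(2)] Y2[OF a' \<sigma>X(1)[OF xZ] \<sigma>X(1)[OF yZ]] by (auto simp: Y'_def)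
    qed
    show "adj (Y' a x) (Y' b x)" if "b < Suc n" "b \<noteq> a" for b
      using Y3[of a "\<sigma> x" b] Y1(3)[of b "\<sigma> x"] sym[OF Y1(3)[of a "\<sigma> x"]] \<sigma>X(1)[OF xZ] a that
      by (auto simp: Y'_def less_Suc_eq)
    show "adj p (Y' a x)"
      if "p \<in> Z'" "q \<in> Z'" "adj p q \<and> key p < key (Y' a x) \<and> key (Y' a x) < key q" for p q
    proof (cases "a = n")
      case True
      then show ?thesis using that wall[of p q "\<sigma> x"] \<sigma>(1)[OF xZ] Z'Z by (auto simp: Y'_def)
    next
      case False
      have "p \<in> X" "q \<in> X" using that Z'Z sub by auto
      then show ?thesis using False that Y4[OF a' \<sigma>X(1)[OF xZ]] by (auto simp: Y'_def)
    qed
    show "colourable adj {p \<in> Z'. key x \<le> key p \<and> key p < key (Y' a x)} (Suc n * c)"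
    proof (cases "a = n")
      case True
      then show ?thesis using Z'Z by (intro colourable_mono[OF near[OF xZ]]) (auto simp: Y'_def)
    next
      case False
      then show ?thesis using Z'Z by (intro colourable_mono[OF far[OF a' xZ]]) (auto simp: Y'_def)
    qed
  qed
  then have "colourable adj (Z' \<union> (\<Union>a\<in>{..<n}. bad a)) (m + card {..<n} * (2 * (Suc n * c)))"
    using bad by (intro colourable_Un cont Z'Z colourable_UN) auto
  then show ?thesis by (rule colourable_mono) (auto simp: Z'_def)
qed

section \<open>Pockets\<close>

context grounded
begin

lemma escape:
  assumes V: "u \<in> V" "v \<in> V" "z \<in> V" "w \<in> V" and uv: "adj u v" "adj z w"
    and z: "key u < key z" "key z < key v" "\<not> adj u z" "\<not> adj z v"
    and w: "\<not> adj u w" "\<not> adj w v"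
  shows "key u < key w" "key w < key v"
proof -
  have rz: "r z < r u" "r z < r v" using between[of u z v] assms by auto
  have ne: "w \<noteq> u" "w \<noteq> v" using uv z sym by metis+
  have "\<not> key w < key u"
  proof
    assume "key w < key u"
    then have "r u < r z" using between[of w u z] V z w uv sym by blast
    then show False using rz by simp
  qed
  then show "key u < key w" using ne V inj_onD[OF inj, of w u] by fastforce
  have "\<not> key v < key w"
  proof
    assume "key v < key w"
    then have "r v < r z" using between[of z v w] V z w uv sym by blast
    then show False using rz by simp
  qed
  then show "key w < key v" using ne V inj_onD[OF inj, of w v] by fastforce
qed

lemma wall_right_contiguous:
  assumes "u \<in> V" "p \<in> V" "s \<in> V" "t \<in> V" "key u < key p" "\<not> adj u p"
    and "key p < key s" "key s < key t" "adj u s" "adj p t" "\<not> adj s t"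
  shows "adj p s"
  using between(2)[of u p s] between(1)[of p s t] assms by fastforce

lemma wall_left_long:
  assumes "u \<in> V" "p \<in> V" "s \<in> V" "\<not> adj u p" "r p < r u"
    and "key u < key s" "key s < key p" "adj u s" "adj s p"
  shows "r p < r s" "f p (r p) \<le> f s (r p)"
proof -
  show "r p < r s"
  proof (rule ccontr)
    assume "\<not> r p < r s"
    then have "f p (r s) \<le> f s (r s)" "f s (r s) \<le> f u (r s)"
      using cross[of s p] cross[of u s] assms by (auto simp: min_def split: if_splits)
    moreover have "f u (r s) < f p (r s)"
      using not_adj_above[of u p "r s"] assms start[of s] \<open>\<not> r p < r s\<close> by simp
    ultimately show False by simp
  qed
  then show "f p (r p) \<le> f s (r p)" using cross[of s p] assms by simp
qed

lemma wall_dead: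
  assumes "u \<in> V" "p \<in> V" "s \<in> V" "t \<in> V" "\<not> adj u p" "r p < r u"
    and "key u < key s" "key s < key p" "key s < key t" "adj u s" "adj u t" "adj s p" "\<not> adj s t"
  shows "r p \<le> r t"
proof (rule ccontr)
  assume "\<not> r p \<le> r t"
  note long = wall_left_long[OF assms(1,2,3,5,6,7,8,10,12)]
  have "f t (r t) \<le> f u (r t)"
    using cross[of u t] assms \<open>\<not> r p \<le> r t\<close> by (auto simp: min_def split: if_splits)
  moreover have "f s (r t) < f t (r t)"
    using not_adj_above[of s t "r t"] assms start[of t] long \<open>\<not> r p \<le> r t\<close> by simp
  ultimately have "f s (r t) \<le> f u (r t)" by simp
  then have "f s (r p) \<le> f u (r p)"
    using once[of u s "r t" "r p"] assms start[of t] long \<open>\<not> r p \<le> r t\<close> by simp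
  moreover have "f u (r p) < f p (r p)"
    using not_adj_above[of u p "r p"] assms start[of p] by simp
  ultimately show False using long by simp
qed

lemma wall_left_contiguous:
  assumes "u \<in> V" "p \<in> V" "s \<in> V" "t \<in> V" "\<not> adj u p" "r p < r u"
    and "key u < key s" "key s < key t" "key t < key p" "adj u s" "adj u t" "adj s p" "\<not> adj s t"
  shows "adj t p"
proof (rule ccontr)
  assume not: "\<not> adj t p"
  have sp: "key s < key p" using assms by simp
  note long = wall_left_long[OF assms(1,2,3,5,6,7) sp assms(10,12)]
  have "r p \<le> r t" using wall_dead[of u p s t] assms sp by blast
  moreover from this have "f t (r p) < f p (r p)"
    using not_adj_above[of t p "r p"] assms not start[of p] by simp
  ultimately have "adj s t"
    using adj_flip[of s t "r p"] assms long start[of p] by simp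
  then show False using assms by simp
qed

lemma wall_one_side:
  assumes "u \<in> V" "p \<in> V" "s \<in> V" "t \<in> V" "\<not> adj u p" "r p < r u"
    and "key u < key s" "key s < key p" "key p < key t" "adj u s" "adj u t" "adj s p" "\<not> adj s t"
  shows "\<not> adj p t"
proof
  assume pt: "adj p t"
  have st: "key s < key t" using assms by simp
  note long = wall_left_long[OF assms(1,2,3,5,6,7,8,10,12)]
  have "r p \<le> r t" using wall_dead[of u p s t] assms st by blast
  moreover from this have "f t (r p) \<le> f p (r p)" using cross[of p t] pt assms by simp
  ultimately have "adj s t"
    using adj_flip[of s t "r p"] assms st long start[of p] by simp
  then show False using assms by simp
qed

lemma wall_separates:
  assumes "u \<in> V" "p \<in> V" "q \<in> V" "s \<in> V" "key u < key p" "\<not> adj u p"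
    and "key p < key s" "key s < key q" "adj u s" "adj p q"
  shows "adj p s \<or> adj s q"
  using between(2)[of u p s] between(1)[of p s q] assms by fastforce

lemma pocket_colourable:
  assumes P: "P \<subseteq> V"
    and pocket: "\<And>u v. u \<in> P \<Longrightarrow> v \<in> P \<Longrightarrow> key u < key v \<Longrightarrow> adj u v \<Longrightarrow>
                   colourable adj {p \<in> P. key u < key p \<and> key p < key v} n"
  shows "colourable adj P (2 * (n + 2))"
proof (rule colourable_blocks[where key = key and
      R = "\<lambda>p q. colourable adj {x \<in> P. key p \<le> key x \<and> key x < key q} (n + 1)"])
  show "finite P" using P fin finite_subset by blast
  show injP: "inj_on key P" using P inj inj_on_subset by blast
  have single: "colourable adj {x} 1" for x
    by (intro colourable_independent) (auto simp: irr)
  show "colourable adj {x \<in> P. key p \<le> key x \<and> key x < key q} (n + 1)"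
    if "p \<in> P" "q \<in> P" "key p < key q" "adj p q" for p q
    by (rule colourable_mono[OF colourable_Un[OF pocket[OF that] single[of p]]])
      (use injP that in \<open>auto dest: inj_onD simp: order_le_less\<close>)
  show "colourable adj {x \<in> P. key p' \<le> key x \<and> key x < key q} (n + 1)"
    if "key p \<le> key p'" "colourable adj {x \<in> P. key p \<le> key x \<and> key x < key q} (n + 1)" for p p' q
    by (rule colourable_mono[OF that(2)]) (use that in auto)
  show "colourable adj {x \<in> P. key p \<le> key x \<and> key x < key q'} (n + 1)"
    if "key q' \<le> key q" "colourable adj {x \<in> P. key p \<le> key x \<and> key x < key q} (n + 1)" for p q q'
    by (rule colourable_mono[OF that(2)]) (use that in auto)
  show "colourable adj {q \<in> P. q = x \<or> key x < key q \<and>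
      colourable adj {y \<in> P. key x \<le> key y \<and> key y < key q} (n + 1)} (n + 2)"
    if x: "x \<in> P" for x
  proof -
    let ?B = "{q \<in> P. q = x \<or> key x < key q \<and>
      colourable adj {y \<in> P. key x \<le> key y \<and> key y < key q} (n + 1)}"
    have "finite ?B" "?B \<noteq> {}" using \<open>finite P\<close> x by auto
    then obtain q where q: "q \<in> ?B" "\<forall>y\<in>?B. - key q \<le> - key y"
      using ex_min_key[of ?B "\<lambda>q. - key q"] by blast
    have "colourable adj {y \<in> P. key x \<le> key y \<and> key y < key q} (n + 1)"
    proof (cases "q = x")
      case True
      then have empty: "{y \<in> P. key x \<le> key y \<and> key y < key q} = {}" by auto
      show ?thesis unfolding empty by (simp add: colourable_def)
    qed (use q in auto)
    from colourable_Un[OF this single[of q]]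
    have "colourable adj ({y \<in> P. key x \<le> key y \<and> key y < key q} \<union> {q}) (n + 2)" by simp
    moreover have "?B \<subseteq> {y \<in> P. key x \<le> key y \<and> key y < key q} \<union> {q}"
    proof
      fix y assume y: "y \<in> ?B"
      then have "key y \<le> key q" using q by auto
      moreover have "key y \<noteq> key q" if "y \<noteq> q" using injP that y q by (auto dest: inj_onD)
      ultimately show "y \<in> {y \<in> P. key x \<le> key y \<and> key y < key q} \<union> {q}"
        using y by fastforce
    qed
    ultimately show ?thesis by (rule colourable_mono) simp
  qed
qed (use irr sym in auto)

text \<open>The path from a support of a trapped vertex back to the root avoids the neighbours of
  \<open>u\<close> and \<open>v\<close>, except perhaps at the support itself; so it can leave the pocket only there.\<close>

lemma layer_support:
  assumes X: "X \<subseteq> V" "x0 \<in> X" and root: "\<And>z. z \<in> component adj X x0 \<Longrightarrow> key x0 \<le> key z"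
    and L: "u \<in> layer adj X x0 d" "v \<in> layer adj X x0 d" "p \<in> layer adj X x0 d"
    and uv: "adj u v" and p: "key u < key p" "key p < key v" "\<not> adj u p" "\<not> adj p v"
  shows "\<exists>s\<in>X. adj s p \<and> (adj s u \<or> adj s v)"
proof -
  have LX: "layer adj X x0 e \<subseteq> X" for e using layer_subset X by metis
  have uvX: "u \<in> X" "v \<in> X" "p \<in> X" using L LX by auto
  have free: "\<not> (key u < key z \<and> key z < key v \<and> \<not> adj u z \<and> \<not> adj z v)"
    if "e < d" "z \<in> layer adj X x0 e" for e z
    using that
  proof (induction e arbitrary: z)
    case 0
    then have "z = x0" by (simp add: layer_0)
    then show ?case using root[of u] L(1) layer_subset_component by fastforce
  next
    case (Suc e)
    show ?case
    proof
      assume z: "key u < key z \<and> key z < key v \<and> \<not> adj u z \<and> \<not> adj z v"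
      obtain w where w: "w \<in> layer adj X x0 e" "w \<in> X" "adj w z"
        using layer_parent[OF Suc.prems(2)] by blast
      have "z \<in> X" using Suc.prems LX by blast
      have "\<not> adj u w"
        using layer_adj_le[OF w(1) L(1) w(2) uvX(1)] sym Suc.prems(1) by fastforce
      moreover have "\<not> adj w v"
        using layer_adj_le[OF w(1) L(2) w(2) uvX(2)] Suc.prems(1) by fastforce
      ultimately show False
        using escape[of u v z w] Suc.IH[of w] Suc.prems(1) w z uvX uv X \<open>z \<in> X\<close> sym
        by (meson Suc_lessD subsetD)
    qed
  qed
  have "d \<noteq> 0"
    using L uv irr by (metis layer_0 singletonD)
  then obtain e where d: "d = Suc e" by (cases d) auto
  obtain s where s: "s \<in> layer adj X x0 e" "s \<in> X" "adj s p"
    using layer_parent L(3) unfolding d by metis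
  have "adj s u \<or> adj s v"
  proof (rule ccontr)
    assume "\<not> (adj s u \<or> adj s v)"
    then have "\<not> adj u s" "\<not> adj s v" using sym by blast+
    then show False
      using escape[of u v p s] free[of e s] s uvX X uv p sym d by (meson lessI subsetD)
  qed
  then show ?thesis using s by blast
qed

end

fun level_bound :: "nat \<Rightarrow> nat \<Rightarrow> nat \<Rightarrow> nat" where
  "level_bound c m 0 = Suc c * Suc c * c * (2 * c + 1)"
| "level_bound c m (Suc d) = Suc c * Suc c * c * (2 * c + 1) +
     2 * (2 * (c + c + (level_bound c m d + level_bound c m d +
       4 * (c * (level_bound c m d + m * (2 * (Suc m * c))))) + 2))"

locale bounded_grounded = grounded +
  fixes c m :: nat
  assumes nb: "v \<in> V \<Longrightarrow> colourable adj {x \<in> V. adj v x} c"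
    and cliques: "K \<subseteq> V \<Longrightarrow> finite K \<Longrightarrow> \<forall>x\<in>K. \<forall>y\<in>K. x \<noteq> y \<longrightarrow> adj x y \<Longrightarrow> card K \<le> m"
begin

lemma bounded_mirror: "bounded_grounded V t0 (\<lambda>i x. - f i x) r adj c m"
  using mirror nb cliques
  by (auto intro!: bounded_grounded.intro bounded_grounded_axioms.intro)

lemma wall_class_right:
  assumes w: "walled adj key V c n X" and X: "X \<subseteq> V" "W \<subseteq> X" "T \<subseteq> X" and u: "u \<in> V"
    and W: "\<And>p. p \<in> W \<Longrightarrow> key u < key p \<and> \<not> adj u p \<and> r p < r u"
    and cont: "\<And>Z. Z \<subseteq> W \<Longrightarrow> walled adj key V c (Suc n) Z \<Longrightarrow> colourable adj Z k"
  shows "colourable adj {p \<in> W. \<exists>s\<in>T. adj u s \<and> key p < key s \<and> adj s p} (c * (k + n * (2 * (Suc n * c))))"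
proof -
  obtain \<kappa> where \<kappa>: "\<And>x. x \<in> V \<Longrightarrow> adj u x \<Longrightarrow> \<kappa> x < c"
      "\<And>x y. x \<in> V \<Longrightarrow> y \<in> V \<Longrightarrow> adj u x \<Longrightarrow> adj u y \<Longrightarrow> adj x y \<Longrightarrow> \<kappa> x \<noteq> \<kappa> y"
    using nb[OF u] unfolding colourable_def by auto
  have VV: "x \<in> V" if "x \<in> W \<or> x \<in> T" for x using that X by auto
  have "colourable adj {p \<in> W. \<exists>s\<in>T. adj u s \<and> \<kappa> s = \<alpha> \<and> key p < key s \<and> adj s p} (k + n * (2 * (Suc n * c)))"
    for \<alpha>
  proof (rule walled_step[OF fin inj irr sym nb w X(1), where S = "{s \<in> T. adj u s \<and> \<kappa> s = \<alpha>}"])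
    let ?S = "{s \<in> T. adj u s \<and> \<kappa> s = \<alpha>}"
    let ?Z = "{p \<in> W. \<exists>s\<in>T. adj u s \<and> \<kappa> s = \<alpha> \<and> key p < key s \<and> adj s p}"
    have indep: "\<not> adj s t" if "s \<in> ?S" "t \<in> ?S" for s t
      using that \<kappa>(2)[of s t] VV by auto
    show "?Z \<subseteq> X" "?S \<subseteq> X" using X by auto
    show "\<exists>s\<in>?S. key z < key s" if "z \<in> ?Z" for z using that by auto
    show "adj z s"
      if z: "z \<in> ?Z" and s: "s \<in> ?S" "key z < key s" "\<forall>s'\<in>?S. key z < key s' \<longrightarrow> key s \<le> key s'" for z s
    proof -
      obtain t where t: "t \<in> ?S" "key z < key t" "adj t z" using z by auto
      show ?thesis
      proof (cases "s = t")
        case False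
        have V': "s \<in> V" "t \<in> V" "z \<in> V" using VV s t z by auto
        have "key s \<le> key t" using s t by blast
        moreover have "key s \<noteq> key t" using False inj_onD[OF inj, of s t] V' by auto
        moreover have "adj u s" "adj z t" "\<not> adj s t" "key u < key z" "\<not> adj u z"
          using s t z W[of z] indep[OF s(1) t(1)] sym[OF t(3)] by auto
        ultimately show ?thesis
          using wall_right_contiguous[of u z s t] V' s u by simp
      qed (use t sym in auto)
    qed
    show "adj p s"
      if p: "p \<in> ?Z" and q: "q \<in> ?Z" and s: "s \<in> ?S" and pq: "adj p q" "key p < key s" "key s < key q" for p q s
    proof -
      obtain t where t: "t \<in> ?S" "key q < key t" "adj t q" using q by auto
      have V': "s \<in> V" "t \<in> V" "p \<in> V" "q \<in> V" using VV s t p q by auto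
      have Wp: "key u < key p" "\<not> adj u p" and Wq: "\<not> adj u q" "r q < r u"
        using W[of p] W[of q] p q by auto
      have st: "adj u s" "adj u t" "\<not> adj s t" using s t indep[OF s t(1)] by auto
      have "\<not> adj s q"
        using wall_one_side[of u q s t] V' u Wp Wq st pq t sym[OF t(3)] by auto
      then show ?thesis
        using wall_separates[of u p q s] V' u Wp st pq by auto
    qed
    show "colourable adj Z' k" if "Z' \<subseteq> ?Z" "walled adj key V c (Suc n) Z'" for Z'
      using that by (intro cont) auto
  qed
  then have "colourable adj (\<Union>\<alpha>\<in>{..<c}. {p \<in> W. \<exists>s\<in>T. adj u s \<and> \<kappa> s = \<alpha> \<and> key p < key s \<and> adj s p})
      (card {..<c} * (k + n * (2 * (Suc n * c))))"
    by (intro colourable_UN) auto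
  then show ?thesis
    by (rule colourable_mono) (use \<kappa>(1) VV in auto)
qed

lemma wall_class_left:
  assumes w: "walled adj (\<lambda>i. - key i) V c n X" and X: "X \<subseteq> V" "W \<subseteq> X" "T \<subseteq> X" and u: "u \<in> V"
    and W: "\<And>p. p \<in> W \<Longrightarrow> key u < key p \<and> \<not> adj u p \<and> r p < r u"
    and cont: "\<And>Z. Z \<subseteq> W \<Longrightarrow> walled adj (\<lambda>i. - key i) V c (Suc n) Z \<Longrightarrow> colourable adj Z k"
  shows "colourable adj {p \<in> W. \<exists>s\<in>T. adj u s \<and> key u < key s \<and> key s < key p \<and> adj s p}
           (c * (k + n * (2 * (Suc n * c))))"
proof -
  obtain \<kappa> where \<kappa>: "\<And>x. x \<in> V \<Longrightarrow> adj u x \<Longrightarrow> \<kappa> x < c"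
      "\<And>x y. x \<in> V \<Longrightarrow> y \<in> V \<Longrightarrow> adj u x \<Longrightarrow> adj u y \<Longrightarrow> adj x y \<Longrightarrow> \<kappa> x \<noteq> \<kappa> y"
    using nb[OF u] unfolding colourable_def by auto
  have VV: "x \<in> V" if "x \<in> W \<or> x \<in> T" for x using that X by auto
  have inj': "inj_on (\<lambda>i. - key i) V" using inj by (auto simp: inj_on_def)
  have "colourable adj {p \<in> W. \<exists>s\<in>T. adj u s \<and> key u < key s \<and> \<kappa> s = \<alpha> \<and> key s < key p \<and> adj s p}
      (k + n * (2 * (Suc n * c)))" for \<alpha>
  proof (rule walled_step[OF fin inj' irr sym nb w X(1),
        where S = "{s \<in> T. adj u s \<and> key u < key s \<and> \<kappa> s = \<alpha>}"])
    let ?S = "{s \<in> T. adj u s \<and> key u < key s \<and> \<kappa> s = \<alpha>}"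
    let ?Z = "{p \<in> W. \<exists>s\<in>T. adj u s \<and> key u < key s \<and> \<kappa> s = \<alpha> \<and> key s < key p \<and> adj s p}"
    have indep: "\<not> adj s t" if "s \<in> ?S" "t \<in> ?S" for s t
      using that \<kappa>(2)[of s t] VV by auto
    show "?Z \<subseteq> X" "?S \<subseteq> X" using X by auto
    show "\<exists>s\<in>?S. - key z < - key s" if "z \<in> ?Z" for z using that by auto
    show "adj z s"
      if z: "z \<in> ?Z" and s: "s \<in> ?S" "- key z < - key s" "\<forall>s'\<in>?S. - key z < - key s' \<longrightarrow> - key s \<le> - key s'"
      for z s
    proof -
      obtain t where t: "t \<in> ?S" "key t < key z" "adj t z" using z by auto
      show ?thesis
      proof (cases "s = t")
        case False
        have V': "s \<in> V" "t \<in> V" "z \<in> V" using VV s t z by auto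
        have "- key s \<le> - key t" using bspec[OF s(3) t(1)] t(2) by simp
        moreover have "key s \<noteq> key t" using False inj_onD[OF inj, of s t] V' by auto
        moreover have "adj u s" "adj u t" "adj t z" "\<not> adj t s" "key u < key t" "\<not> adj u z" "r z < r u"
          using s t z W[of z] indep[OF t(1) s(1)] by auto
        ultimately have "adj s z"
          using wall_left_contiguous[of u z t s] V' s(2) u by simp
        then show ?thesis by (rule sym)
      qed (use t sym in auto)
    qed
    show "adj p s"
      if p: "p \<in> ?Z" and q: "q \<in> ?Z" and s: "s \<in> ?S" and pq: "adj p q" "- key p < - key s" "- key s < - key q"
      for p q s
    proof -
      obtain t where t: "t \<in> ?S" "key t < key q" "adj t q" using q by auto
      have V': "s \<in> V" "t \<in> V" "p \<in> V" "q \<in> V" using VV s t p q by auto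
      have Wq: "key u < key q" "\<not> adj u q" "r q < r u"
        using W[of q] q by auto
      have st: "adj u s" "adj u t" "key u < key t" "\<not> adj t s" using s t indep[OF t(1) s] by auto
      have "\<not> adj q s"
        using wall_one_side[of u q t s] V' u Wq st pq t by auto
      then have "adj s p"
        using wall_separates[of u q p s] V' u Wq st pq sym[OF pq(1)] by auto
      then show ?thesis by (rule sym)
    qed
    show "colourable adj Z' k" if "Z' \<subseteq> ?Z" "walled adj (\<lambda>i. - key i) V c (Suc n) Z'" for Z'
      using that by (intro cont) auto
  qed
  then have "colourable adj (\<Union>\<alpha>\<in>{..<c}. {p \<in> W. \<exists>s\<in>T. adj u s \<and> key u < key s \<and> \<kappa> s = \<alpha> \<and> key s < key p \<and> adj s p})
      (card {..<c} * (k + n * (2 * (Suc n * c))))"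
    by (intro colourable_UN) auto
  then show ?thesis
    by (rule colourable_mono) (use \<kappa>(1) VV in auto)
qed

lemma saturated_colourable:
  assumes X: "X \<subseteq> V" and c: "c < M" "m \<le> M"
    and sat: "nested_left adj key V M X \<or> walled adj key V c M X"
  shows "colourable adj X (Suc c * Suc c * c * (2 * c + 1))"
proof (cases "nested_left adj key V M X")
  case True
  then have "nested_left adj key V (Suc c) X"
    using nested_left_mono c by (metis Suc_leI order_refl)
  then show ?thesis using nested_left_colourable[OF nb _ X] by blast
next
  case False
  then have "X = {}"
    using sat cliques c(2) irr sym X
    by (intro walled_empty[where adj = adj and key = key and V = V and c = c and n = M])
      (auto intro: order_trans)
  then show ?thesis by (simp add: colourable_def)
qed

lemma pocket_classes_colourable:
  assumes X: "X \<subseteq> V" "P \<subseteq> X" and uv: "u \<in> X" "v \<in> X" "adj u v"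
    and supp: "\<And>p. p \<in> P \<Longrightarrow> key u < key p \<Longrightarrow> key p < key v \<Longrightarrow> \<not> adj u p \<Longrightarrow> \<not> adj p v \<Longrightarrow>
                 \<exists>s\<in>X. adj s p \<and> (adj s u \<or> adj s v)"
    and ranks: "nested_left adj key V n1 X" "nested_left adj (\<lambda>i. - key i) V n2 X"
      "walled adj key V c n3 X" "walled adj (\<lambda>i. - key i) V c n4 X"
    and n: "n3 \<le> M" "n4 \<le> M"
    and IH: "\<And>Z. Z \<subseteq> X \<Longrightarrow> nested_left adj key V (Suc n1) Z \<Longrightarrow> colourable adj Z k"
      "\<And>Z. Z \<subseteq> X \<Longrightarrow> nested_left adj (\<lambda>i. - key i) V (Suc n2) Z \<Longrightarrow> colourable adj Z k"
      "\<And>Z. Z \<subseteq> X \<Longrightarrow> walled adj key V c (Suc n3) Z \<Longrightarrow> colourable adj Z k"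
      "\<And>Z. Z \<subseteq> X \<Longrightarrow> walled adj (\<lambda>i. - key i) V c (Suc n4) Z \<Longrightarrow> colourable adj Z k"
  shows "colourable adj {p \<in> P. key u < key p \<and> key p < key v}
           (c + c + (k + k + 4 * (c * (k + M * (2 * (Suc M * c))))))"
proof -
  interpret mir: bounded_grounded V t0 "\<lambda>i x. - f i x" r adj c m by (rule bounded_mirror)
  define W where "W = {p \<in> P. key u < key p \<and> key p < key v \<and> \<not> adj u p \<and> \<not> adj p v}"
  have WX: "W \<subseteq> X" using X by (auto simp: W_def)
  have uV: "u \<in> V" "v \<in> V" using uv X by auto
  have Wu: "key u < key p \<and> \<not> adj u p \<and> r p < r u" if "p \<in> W" for p
    using between[of u p v] that uv(3) uV X by (auto simp: W_def)
  have Wv: "- key v < - key p \<and> \<not> adj v p \<and> r p < r v" if "p \<in> W" for p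
    using between[of u p v] that uv(3) uV X sym by (auto simp: W_def)
  let ?B = "c * (k + M * (2 * (Suc M * c)))"
  have B: "c * (k + n * (2 * (Suc n * c))) \<le> ?B" if "n \<le> M" for n
    using that by (intro mult_le_mono add_mono) auto
  define C1 where "C1 = {p \<in> W. \<exists>s\<in>X. key s < key u \<and> adj s p}"
  define C2 where "C2 = {p \<in> W. \<exists>s\<in>X. - key s < - key v \<and> adj s p}"
  define D1 where "D1 = {p \<in> W. \<exists>s\<in>X. adj u s \<and> key p < key s \<and> adj s p}"
  define D2 where "D2 = {p \<in> W. \<exists>s\<in>X. adj u s \<and> key u < key s \<and> key s < key p \<and> adj s p}"
  define D3 where "D3 = {p \<in> W. \<exists>s\<in>X. adj v s \<and> - key p < - key s \<and> adj s p}"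
  define D4 where "D4 = {p \<in> W. \<exists>s\<in>X. adj v s \<and> - key v < - key s \<and> - key s < - key p \<and> adj s p}"
  have subs: "C1 \<subseteq> X" "C2 \<subseteq> X" using WX by (auto simp: C1_def C2_def)
  have "nested_left adj key V (Suc n1) C1"
    by (rule nested_left_step[OF ranks(1) subs(1) order_refl X(1) uv(1)])
      (use Wu in \<open>auto simp: C1_def\<close>)
  then have C1: "colourable adj C1 k" by (rule IH(1)[OF subs(1)])
  have "nested_left adj (\<lambda>i. - key i) V (Suc n2) C2"
    by (rule mir.nested_left_step[OF ranks(2) subs(2) order_refl X(1) uv(2)])
      (use Wv in \<open>auto simp: C2_def\<close>)
  then have C2: "colourable adj C2 k" by (rule IH(2)[OF subs(2)])
  have D1: "colourable adj D1 ?B" unfolding D1_def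
    by (rule colourable_mono[OF wall_class_right[OF ranks(3) X(1) WX order_refl uV(1) Wu IH(3)]])
      (use WX B[OF n(1)] in auto)
  have D2: "colourable adj D2 ?B" unfolding D2_def
    by (rule colourable_mono[OF wall_class_left[OF ranks(4) X(1) WX order_refl uV(1) Wu IH(4)]])
      (use WX B[OF n(2)] in auto)
  have D3: "colourable adj D3 ?B" unfolding D3_def
    by (rule colourable_mono[OF mir.wall_class_right[OF ranks(4) X(1) WX order_refl uV(2) Wv IH(4)]])
      (use WX B[OF n(2)] in auto)
  have ranks3: "walled adj (\<lambda>i. - (- key i)) V c n3 X" using ranks(3) by simp
  have IH3: "colourable adj Z k" if "Z \<subseteq> W" "walled adj (\<lambda>i. - (- key i)) V c (Suc n3) Z" for Z
    using IH(3)[of Z] that WX by simp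
  have D4: "colourable adj D4 ?B" unfolding D4_def
    by (rule colourable_mono[OF mir.wall_class_left[OF ranks3 X(1) WX order_refl uV(2) Wv IH3]])
      (use B[OF n(1)] in auto)
  have "colourable adj (({x \<in> V. adj u x} \<union> {x \<in> V. adj v x}) \<union> ((C1 \<union> C2) \<union> (((D1 \<union> D2) \<union> D3) \<union> D4)))
      (c + c + (k + k + (?B + ?B + ?B + ?B)))"
    by (intro colourable_Un nb uV C1 C2 D1 D2 D3 D4)
  then show ?thesis
  proof (rule colourable_mono)
    show "{p \<in> P. key u < key p \<and> key p < key v} \<subseteq>
        ({x \<in> V. adj u x} \<union> {x \<in> V. adj v x}) \<union> ((C1 \<union> C2) \<union> (((D1 \<union> D2) \<union> D3) \<union> D4))"
    proof (rule subsetI, rule ccontr)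
      fix p
      assume p: "p \<in> {p \<in> P. key u < key p \<and> key p < key v}"
        and not: "p \<notin> ({x \<in> V. adj u x} \<union> {x \<in> V. adj v x}) \<union> ((C1 \<union> C2) \<union> (((D1 \<union> D2) \<union> D3) \<union> D4))"
      have pV: "p \<in> V" using p X by auto
      have na: "\<not> adj u p" "\<not> adj v p" "\<not> adj p v" using not pV sym by auto
      then have pW: "p \<in> W" using p by (simp add: W_def)
      obtain s where s: "s \<in> X" "adj s p" "adj s u \<or> adj s v"
        using supp[of p] p na by auto
      have sV: "s \<in> V" using s X by auto
      have ne: "key s \<noteq> key u" "key s \<noteq> key v" "key s \<noteq> key p"
        using s(2) na irr[of p] inj_onD[OF inj, of s u] inj_onD[OF inj, of s v] inj_onD[OF inj, of s p]
          sV uV pV by auto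
      have "p \<notin> C1" "p \<notin> C2" "p \<notin> D1" "p \<notin> D2" "p \<notin> D3" "p \<notin> D4" using not by auto
      then have "\<not> key s < key u" "\<not> key v < key s"
          "\<not> (adj u s \<and> key p < key s)" "\<not> (adj u s \<and> key u < key s \<and> key s < key p)"
          "\<not> (adj v s \<and> key s < key p)" "\<not> (adj v s \<and> key s < key v \<and> key p < key s)"
        using s(1,2) pW by (auto simp: C1_def C2_def D1_def D2_def D3_def D4_def)
      then show False using ne s(3) sym by (meson linorder_neqE_linordered_idom)
    qed
  qed simp
qed

text \<open>The ranks count the levels of each kind found so far; every passage to a pocket and its
  supports increases one of them.\<close>

lemma colourable_level:
  assumes X: "X \<subseteq> V"
    and ranks: "nested_left adj key V n1 X" "nested_left adj (\<lambda>i. - key i) V n2 X"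
      "walled adj key V c n3 X" "walled adj (\<lambda>i. - key i) V c n4 X"
    and le: "n1 \<le> M" "n2 \<le> M" "n3 \<le> M" "n4 \<le> M"
    and d: "n1 + n2 + n3 + n4 + d = 4 * M" and M: "c < M" "m \<le> M"
  shows "colourable adj X (level_bound c M d)"
  using X ranks le d
proof (induction d arbitrary: X n1 n2 n3 n4)
  case 0
  then have "n1 = M" by linarith
  then show ?case
    unfolding level_bound.simps using saturated_colourable[OF "0.prems"(1) M] "0.prems"(2) by blast
next
  case (Suc d)
  interpret mir: bounded_grounded V t0 "\<lambda>i x. - f i x" r adj c m by (rule bounded_mirror)
  note X = Suc.prems(1) and ranks = Suc.prems(2-5)
  let ?A = "level_bound c M d"
  let ?b = "c + c + (?A + ?A + 4 * (c * (?A + M * (2 * (Suc M * c)))))"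
  show ?case
  proof (cases "n1 = M \<or> n2 = M \<or> n3 = M \<or> n4 = M")
    case True
    then have "colourable adj X (Suc c * Suc c * c * (2 * c + 1))"
      using saturated_colourable[OF X M] mir.saturated_colourable[OF X M] ranks by blast
    then show ?thesis by (rule colourable_mono) simp_all
  next
    case False
    then have lt: "n1 < M" "n2 < M" "n3 < M" "n4 < M" using Suc.prems by auto
    have sub: "nested_left adj key V n1 Z" "nested_left adj (\<lambda>i. - key i) V n2 Z"
      "walled adj key V c n3 Z" "walled adj (\<lambda>i. - key i) V c n4 Z" if "Z \<subseteq> X" for Z
      using nested_left_mono[OF ranks(1) that order_refl] nested_left_mono[OF ranks(2) that order_refl]
        walled_subset[OF ranks(3) that] walled_subset[OF ranks(4) that] by auto
    have IH: "\<And>Z. Z \<subseteq> X \<Longrightarrow> nested_left adj key V (Suc n1) Z \<Longrightarrow> colourable adj Z ?A"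
      "\<And>Z. Z \<subseteq> X \<Longrightarrow> nested_left adj (\<lambda>i. - key i) V (Suc n2) Z \<Longrightarrow> colourable adj Z ?A"
      "\<And>Z. Z \<subseteq> X \<Longrightarrow> walled adj key V c (Suc n3) Z \<Longrightarrow> colourable adj Z ?A"
      "\<And>Z. Z \<subseteq> X \<Longrightarrow> walled adj (\<lambda>i. - key i) V c (Suc n4) Z \<Longrightarrow> colourable adj Z ?A"
      using Suc.IH[of _ "Suc n1" n2 n3 n4] Suc.IH[of _ n1 "Suc n2" n3 n4]
        Suc.IH[of _ n1 n2 "Suc n3" n4] Suc.IH[of _ n1 n2 n3 "Suc n4"] sub lt Suc.prems(10) X
      by (simp_all add: subset_trans[OF _ X])
    have "colourable adj X (2 * (2 * (?b + 2)))"
    proof (rule colourable_layers[where key = key])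
      show "finite X" using X fin finite_subset by blast
      show "inj_on key X" using X inj inj_on_subset by blast
      fix x0 e
      assume x0: "x0 \<in> X" "\<forall>z\<in>component adj X x0. key x0 \<le> key z"
      let ?P = "layer adj X x0 e"
      have PX: "?P \<subseteq> X" using layer_subset[OF x0(1)] .
      show "colourable adj ?P (2 * (?b + 2))"
      proof (rule pocket_colourable)
        show "?P \<subseteq> V" using PX X by blast
        fix u v assume uv: "u \<in> ?P" "v \<in> ?P" "key u < key v" "adj u v"
        show "colourable adj {p \<in> ?P. key u < key p \<and> key p < key v} ?b"
        proof (rule pocket_classes_colourable[OF X PX _ _ uv(4) _ ranks _ _ IH])
          show "\<exists>s\<in>X. adj s p \<and> (adj s u \<or> adj s v)"
            if "p \<in> ?P" "key u < key p" "key p < key v" "\<not> adj u p" "\<not> adj p v" for p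
            using layer_support[OF X x0(1) _ uv(1,2) that(1) uv(4) that(2-5)] x0(2) by blast
        qed (use uv PX lt in auto)
      qed
    qed (use sym in auto)
    then show ?thesis by (rule colourable_mono) simp_all
  qed
qed

theorem colourable_by_neighbourhoods:
  "colourable adj V (level_bound c (Suc (c + m)) (4 * Suc (c + m)))"
  by (rule colourable_level[where ?n1.0 = 0 and ?n2.0 = 0 and ?n3.0 = 0 and ?n4.0 = 0])
    (simp_all add: nested_left_0 walled_0)

end

fun clique_bound :: "nat \<Rightarrow> nat" where
  "clique_bound 0 = 0"
| "clique_bound (Suc k) = level_bound (clique_bound k) (Suc (clique_bound k + Suc k))
     (4 * Suc (clique_bound k + Suc k))"

lemma (in grounded) grounded_subset:
  assumes "W \<subseteq> V"
  shows "grounded W t0 f r adj"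
proof
  show "finite W" using assms fin finite_subset by blast
  show "inj_on (\<lambda>i. f i t0) W" using assms inj inj_on_subset by blast
  have V: "i \<in> V" if "i \<in> W" for i using assms that by blast
  show "t0 \<le> r i" if "i \<in> W" for i using start V that by simp
  show "adj i j \<longleftrightarrow> f j (min (r i) (r j)) \<le> f i (min (r i) (r j))"
    if "i \<in> W" "j \<in> W" "f i t0 < f j t0" for i j
    using cross V that by simp
  show "f j x' \<le> f i x'"
    if "i \<in> W" "j \<in> W" "f i t0 < f j t0" "t0 \<le> x" "x \<le> x'" "x' \<le> r i" "x' \<le> r j" "f j x \<le> f i x"
    for i j x x'
    using once[of i j x x'] V that by simp
qed (use irr sym in auto)

lemma grounded_colourable:
  assumes "grounded V t0 f r adj"
    and "\<And>K. K \<subseteq> V \<Longrightarrow> finite K \<Longrightarrow> \<forall>x\<in>K. \<forall>y\<in>K. x \<noteq> y \<longrightarrow> adj x y \<Longrightarrow> card K \<le> k"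
  shows "colourable adj V (clique_bound k)"
  using assms
proof (induction k arbitrary: V)
  case 0
  have "V = {}"
  proof (rule ccontr)
    assume "V \<noteq> {}"
    then obtain x where "x \<in> V" by blast
    then show False using "0.prems"(2)[of "{x}"] by simp
  qed
  then show ?case by (simp add: colourable_def)
next
  case (Suc k)
  interpret grounded V t0 f r adj by (rule Suc.prems(1))
  have "bounded_grounded V t0 f r adj (clique_bound k) (Suc k)"
  proof unfold_locales
    fix v assume v: "v \<in> V"
    have sub: "{x \<in> V. adj v x} \<subseteq> V" by blast
    show "colourable adj {x \<in> V. adj v x} (clique_bound k)"
    proof (rule Suc.IH[OF grounded_subset[OF sub]])
      fix K assume K: "K \<subseteq> {x \<in> V. adj v x}" "finite K" "\<forall>x\<in>K. \<forall>y\<in>K. x \<noteq> y \<longrightarrow> adj x y"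
      then have "card (insert v K) \<le> Suc k"
        using v sym by (intro Suc.prems(2)) auto
      moreover have "v \<notin> K" using K irr by auto
      ultimately show "card K \<le> k" using K by simp
    qed
  qed (use Suc.prems(2) in auto)
  then show ?case
    using bounded_grounded.colourable_by_neighbourhoods by fastforce
qed

section \<open>Curves in the plane\<close>

lemma colourable_product:
  assumes "colourable adj1 X m" "colourable adj2 X n"
    and "\<And>x y. x \<in> X \<Longrightarrow> y \<in> X \<Longrightarrow> adj x y \<Longrightarrow> adj1 x y \<or> adj2 x y"
  shows "colourable adj X (m * n)"
proof -
  obtain \<kappa> where \<kappa>: "\<forall>x\<in>X. \<kappa> x < m" "\<forall>x\<in>X. \<forall>y\<in>X. adj1 x y \<longrightarrow> \<kappa> x \<noteq> \<kappa> y"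
    using assms(1) unfolding colourable_def by blast
  obtain \<mu> where \<mu>: "\<forall>x\<in>X. \<mu> x < n" "\<forall>x\<in>X. \<forall>y\<in>X. adj2 x y \<longrightarrow> \<mu> x \<noteq> \<mu> y"
    using assms(2) unfolding colourable_def by blast
  have "\<kappa> x * n + \<mu> x < m * n" if "x \<in> X" for x
  proof -
    have "\<kappa> x * n + \<mu> x < Suc (\<kappa> x) * n" using \<mu>(1) that by simp
    also have "\<dots> \<le> m * n" using \<kappa>(1) that by (intro mult_le_mono) (auto simp: Suc_le_eq)
    finally show ?thesis .
  qed
  moreover have "\<kappa> x * n + \<mu> x \<noteq> \<kappa> y * n + \<mu> y" if xy: "x \<in> X" "y \<in> X" "adj x y" for x y
  proof
    assume eq: "\<kappa> x * n + \<mu> x = \<kappa> y * n + \<mu> y"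
    have "\<mu> x < n" "\<mu> y < n" using \<mu>(1) xy by auto
    then have "(\<kappa> x * n + \<mu> x) div n = \<kappa> x" "(\<kappa> y * n + \<mu> y) div n = \<kappa> y" by auto
    then have "\<kappa> x = \<kappa> y" "\<mu> x = \<mu> y" using eq by auto
    then show False using assms(3)[OF xy] \<kappa>(2) \<mu>(2) xy by blast
  qed
  ultimately show ?thesis
    unfolding colourable_def by (intro exI[of _ "\<lambda>x. \<kappa> x * n + \<mu> x"]) blast
qed

lemma crossing_order:
  fixes g h :: "real \<Rightarrow> real"
  assumes cont: "continuous_on {a..m} g" "continuous_on {a..m} h" and am: "a \<le> m" and start: "g a < h a"
    and unique: "\<And>x y. x \<in> {a..m} \<Longrightarrow> y \<in> {a..m} \<Longrightarrow> g x = h x \<Longrightarrow> g y = h y \<Longrightarrow> x = y"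
    and touch: "\<And>x \<delta>. g x = h x \<Longrightarrow> 0 < \<delta> \<Longrightarrow> {x - \<delta>..x + \<delta>} \<subseteq> {a..m} \<Longrightarrow>
      \<exists>y. y \<noteq> x \<and> \<bar>y - x\<bar> \<le> \<delta> \<and> h y \<le> g y"
  shows "(\<exists>x\<in>{a..m}. g x = h x) \<longleftrightarrow> h m \<le> g m"
    and "\<And>x x'. a \<le> x \<Longrightarrow> x \<le> x' \<Longrightarrow> x' \<le> m \<Longrightarrow> h x \<le> g x \<Longrightarrow> h x' \<le> g x'"
proof -
  have zero: "\<exists>z\<in>{x..y}. g z = h z"
    if "a \<le> x" "x \<le> y" "y \<le> m" "g x \<le> h x \<and> h y \<le> g y \<or> h x \<le> g x \<and> g y \<le> h y" for x y
  proof -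
    have c: "continuous_on {x..y} (\<lambda>z. g z - h z)"
      using that by (intro continuous_on_diff continuous_on_subset[OF cont(1)] continuous_on_subset[OF cont(2)]) auto
    show ?thesis
      using IVT'[of "\<lambda>z. g z - h z" x 0 y] IVT2'[of "\<lambda>z. g z - h z" y 0 x] that c by fastforce
  qed
  have after: "h x' \<le> g x'" if z: "a \<le> z" "z \<le> x'" "x' \<le> m" "g z = h z" for z x'
  proof (rule ccontr)
    assume not: "\<not> h x' \<le> g x'"
    then have "z < x'" "a < z" using z start by (auto simp: order_le_less)
    define \<delta> where "\<delta> = min (z - a) (x' - z)"
    have "0 < \<delta>" "{z - \<delta>..z + \<delta>} \<subseteq> {a..m}" using \<open>z < x'\<close> \<open>a < z\<close> z by (auto simp: \<delta>_def)
    then obtain y where y: "y \<noteq> z" "\<bar>y - z\<bar> \<le> \<delta>" "h y \<le> g y"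
      using touch[of z \<delta>] z \<open>z < x'\<close> \<open>a < z\<close> by auto
    have yr: "a \<le> y" "y \<le> x'" using y(2) by (auto simp: \<delta>_def abs_if split: if_splits)
    show False
    proof (cases "y < z")
      case True
      obtain w where w: "w \<in> {a..y}" "g w = h w" using zero[of a y] start y yr z by auto
      then have "w = z" using unique[of w z] z yr by auto
      then show False using w True by auto
    next
      case False
      obtain w where w: "w \<in> {y..x'}" "g w = h w" using zero[of y x'] y yr z not by auto
      then have "w = z" using unique[of w z] z yr by auto
      then show False using w False y by auto
    qed
  qed
  show "(\<exists>x\<in>{a..m}. g x = h x) \<longleftrightarrow> h m \<le> g m"
    using after[of _ m] zero[of a m] am start by auto
  show "h x' \<le> g x'" if x: "a \<le> x" "x \<le> x'" "x' \<le> m" "h x \<le> g x" for x x'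
  proof -
    obtain z where "z \<in> {a..x}" "g z = h z" using zero[of a x] x start by auto
    then show ?thesis using after[of z x'] x by auto
  qed
qed

text \<open>If the second curve stays above the first one near a common point, then the open region
  above the first graph is connected, avoids the first curve, and contains points of both
  half-axes to which the second curve is mapped.\<close>

lemma not_properly_cross_at_touching:
  fixes g w :: "real \<Rightarrow> real"
  assumes \<delta>: "0 < \<delta>" and cont: "continuous_on {x0 - \<delta>..x0 + \<delta>} g"
    and C: "\<And>x y. \<bar>x - x0\<bar> \<le> \<delta> \<Longrightarrow> (x, y) \<in> C \<longleftrightarrow> y = g x"
    and D: "\<And>x y. \<bar>x - x0\<bar> \<le> \<delta> \<Longrightarrow> (x, y) \<in> D \<longleftrightarrow> y = w x"
    and eq: "g x0 = w x0" and above: "\<And>x. x \<noteq> x0 \<Longrightarrow> \<bar>x - x0\<bar> \<le> \<delta> \<Longrightarrow> g x < w x"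
  shows "\<not> properly_cross_at C D (x0, g x0)"
proof
  assume "properly_cross_at C D (x0, g x0)"
  then obtain U and h k :: "plane \<Rightarrow> plane" where U: "open U" "(x0, g x0) \<in> U" and hom: "homeomorphism U UNIV h k"
    and h0: "h (x0, g x0) = (0, 0)" and hC: "h ` (C \<inter> U) = {z. snd z = 0}" and hD: "h ` (D \<inter> U) = {z. fst z = 0}"
    unfolding properly_cross_at_def by (elim exE conjE)
  have kh: "k (h z) = z" if "z \<in> U" for z using hom that by (simp add: homeomorphism_def)
  obtain e where e: "0 < e" "ball (x0, g x0) e \<subseteq> U" using U open_contains_ball by blast
  define \<epsilon> where "\<epsilon> = e / 2"
  have "\<epsilon> > 0" using e by (simp add: \<epsilon>_def)
  have "isCont g x0"
    using cont \<delta> by (intro continuous_on_interior[OF cont]) (simp add: interior_atLeastAtMost_real)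
  then obtain \<eta> where \<eta>: "0 < \<eta>" "\<And>x. \<bar>x - x0\<bar> < \<eta> \<Longrightarrow> \<bar>g x - g x0\<bar> < \<epsilon>"
    using \<open>\<epsilon> > 0\<close> unfolding continuous_at_eps_delta dist_real_def by blast
  define d where "d = min (min \<delta> \<eta>) \<epsilon>"
  have d: "0 < d" "d \<le> \<delta>" "d \<le> \<eta>" "d \<le> \<epsilon>" using \<delta> \<eta> \<open>\<epsilon> > 0\<close> by (auto simp: d_def)
  have box: "(x, y) \<in> U" if "\<bar>x - x0\<bar> < \<epsilon>" "\<bar>y - g x0\<bar> < \<epsilon>" for x y
  proof -
    have "dist (x0, g x0) (x, y) \<le> dist x0 x + dist (g x0) y"
      by (simp add: dist_Pair_Pair sqrt_sum_squares_le_sum)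
    also have "\<dots> < e" using that by (simp add: dist_real_def abs_minus_commute \<epsilon>_def)
    finally show ?thesis using e by auto
  qed
  define O' where "O' = {(x, y). \<bar>x - x0\<bar> < d \<and> g x < y \<and> y < g x0 + \<epsilon>}"
  have small: "\<bar>g x - g x0\<bar> < \<epsilon>" if "\<bar>x - x0\<bar> < d" for x using \<eta>(2)[of x] that d by auto
  have O'U: "O' \<subseteq> U"
  proof clarify
    fix x y assume "(x, y) \<in> O'"
    then show "(x, y) \<in> U" using box[of x y] small[of x] d by (auto simp: O'_def abs_if split: if_splits)
  qed
  have O'C: "z \<notin> C" if "z \<in> O'" for z
    using that C d by (auto simp: O'_def)
  let ?F = "\<lambda>(x, l). (x, g x + l * (g x0 + \<epsilon> - g x))"
  have "O' = ?F ` ({x0 - d<..<x0 + d} \<times> {0<..<1})"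
  proof (intro equalityI subsetI)
    fix z assume "z \<in> O'"
    then obtain x y where z: "z = (x, y)" "\<bar>x - x0\<bar> < d" "g x < y" "y < g x0 + \<epsilon>" by (auto simp: O'_def)
    define l where "l = (y - g x) / (g x0 + \<epsilon> - g x)"
    have "0 < l" "l < 1" "y = g x + l * (g x0 + \<epsilon> - g x)"
      using z by (auto simp: l_def divide_simps)
    then have "z = ?F (x, l)" "(x, l) \<in> {x0 - d<..<x0 + d} \<times> {0<..<1}" using z by auto
    then show "z \<in> ?F ` ({x0 - d<..<x0 + d} \<times> {0<..<1})" by blast
  next
    fix z assume "z \<in> ?F ` ({x0 - d<..<x0 + d} \<times> {0<..<1})"
    then obtain q where q: "q \<in> {x0 - d<..<x0 + d} \<times> {0<..<1}" "z = ?F q" by blast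
    obtain x l where "q = (x, l)" by (cases q)
    with q have z: "z = (x, g x + l * (g x0 + \<epsilon> - g x))" "\<bar>x - x0\<bar> < d" "0 < l" "l < 1"
      by auto
    have pos: "0 < g x0 + \<epsilon> - g x" using small[OF z(2)] by auto
    then have "0 < l * (g x0 + \<epsilon> - g x)" "l * (g x0 + \<epsilon> - g x) < 1 * (g x0 + \<epsilon> - g x)"
      using z by (auto intro: mult_strict_right_mono)
    then show "z \<in> O'" using z by (auto simp: O'_def)
  qed
  moreover have "connected (?F ` ({x0 - d<..<x0 + d} \<times> {0<..<1}))"
  proof (rule connected_continuous_image)
    have "continuous_on ({x0 - d<..<x0 + d} \<times> {0<..<1::real}) (\<lambda>z. g (fst z))"
      by (rule continuous_on_compose2[OF cont]) (use d in \<open>auto intro: continuous_intros\<close>)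
    then show "continuous_on ({x0 - d<..<x0 + d} \<times> {0<..<1}) ?F"
      unfolding case_prod_beta by (intro continuous_intros)
    show "connected ({x0 - d<..<x0 + d} \<times> {0<..<1::real})"
      by (intro connected_Times connected_Ioo)
  qed
  ultimately have "connected O'" by simp
  have conth: "continuous_on O' (\<lambda>z. snd (h z))"
    using hom O'U by (intro continuous_intros) (auto simp: homeomorphism_def intro: continuous_on_subset)
  have "isCont k (0, 0)"
    using hom by (simp add: homeomorphism_def continuous_on_eq_continuous_at)
  moreover have k0: "k (0, 0) = (x0, g x0)" using kh[OF U(2)] h0 by simp
  ultimately obtain \<tau> where \<tau>: "0 < \<tau>" "\<And>z. dist z (0, 0) < \<tau> \<Longrightarrow> dist (k z) (x0, g x0) < d"
    using d(1) unfolding continuous_at_eps_delta by metis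
  have inO': "k (0, t) \<in> O'" "snd (h (k (0, t))) = t" if "t \<noteq> 0" "\<bar>t\<bar> < \<tau>" for t
  proof -
    have "(0, t) \<in> h ` (D \<inter> U)" using hD by simp
    then obtain z where z: "z \<in> D" "z \<in> U" "h z = (0, t)" by force
    then have kz: "k (0, t) = z" using kh by metis
    have "dist z (x0, g x0) < d" using \<tau>(2)[of "(0, t)"] that kz by (simp add: dist_Pair_Pair dist_real_def)
    moreover obtain x y where xy: "z = (x, y)" by (cases z)
    ultimately have "\<bar>x - x0\<bar> < d" "\<bar>y - g x0\<bar> < d"
      using dist_fst_le[of z "(x0, g x0)"] dist_snd_le[of z "(x0, g x0)"] by (auto simp: dist_real_def)
    moreover from this have "y = w x" using D[of x y] z xy d by auto
    moreover have "x \<noteq> x0" using z h0 that xy eq \<open>y = w x\<close> by auto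
    ultimately show "k (0, t) \<in> O'" using above[of x] d kz xy by (auto simp: O'_def)
    show "snd (h (k (0, t))) = t" using kz z by simp
  qed
  have "connected ((\<lambda>z. snd (h z)) ` O')"
    using conth \<open>connected O'\<close> by (rule connected_continuous_image)
  moreover have "\<tau> / 2 \<in> (\<lambda>z. snd (h z)) ` O'" "- \<tau> / 2 \<in> (\<lambda>z. snd (h z)) ` O'"
    using inO'[of "\<tau> / 2"] inO'[of "- \<tau> / 2"] \<tau>(1) by (force intro: image_eqI)+
  ultimately have "0 \<in> (\<lambda>z. snd (h z)) ` O'"
    using \<tau>(1) connectedD_interval[of _ "- \<tau> / 2" "\<tau> / 2" 0] by auto
  then obtain z where z: "z \<in> O'" "snd (h z) = 0" by auto
  then have "h z \<in> h ` (C \<inter> U)" using hC by simp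
  then obtain z' where "z' \<in> C" "z' \<in> U" "h z' = h z" by auto
  then have "z \<in> C" using kh[of z] kh[of z'] z O'U by auto
  then show False using O'C z by blast
qed

lemma arc_fst_image:
  assumes g: "arc g" "path_image g = C" and mono: "x_monotone C"
  shows "continuous_on {0..1} (\<lambda>t. fst (g t))" "inj_on (\<lambda>t. fst (g t)) {0..1}"
proof -
  show "continuous_on {0..1} (\<lambda>t. fst (g t))"
    using g(1) by (intro continuous_intros) (simp add: arc_def path_def)
  show "inj_on (\<lambda>t. fst (g t)) {0..1}"
  proof (rule inj_onI)
    fix s t :: real
    assume st: "s \<in> {0..1}" "t \<in> {0..1}" "fst (g s) = fst (g t)"
    then have "g s \<in> C \<inter> vertical_line (fst (g s))" "g t \<in> C \<inter> vertical_line (fst (g s))"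
      using g(2) by (auto simp: path_image_def vertical_line_def)
    then have "g s = g t" using mono unfolding x_monotone_def by blast
    then show "s = t" using g(1) st inj_onD[of g "{0..1}" s t] by (simp add: arc_def)
  qed
qed

lemma x_monotone_curve_graph:
  assumes "curve C" and mono: "x_monotone C"
  obtains l r :: real and h where "continuous_on {l..r} h"
    "\<forall>x y. (x, y) \<in> C \<longleftrightarrow> x \<in> {l..r} \<and> y = h x"
    "\<forall>x. l < x \<and> x < r \<longrightarrow> (x, h x) \<in> curve_interior C"
proof -
  obtain g where g: "arc g" "path_image g = C" using assms(1) unfolding curve_def by blast
  define \<phi> where "\<phi> = (\<lambda>t. fst (g t))"
  have \<phi>: "continuous_on {0..1} \<phi>" "inj_on \<phi> {0..1}"
    using arc_fst_image[OF g mono] by (simp_all add: \<phi>_def)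
  have "connected (\<phi> ` {0..1}) \<and> compact (\<phi> ` {0..1})"
    using \<phi>(1) by (simp add: connected_continuous_image compact_continuous_image)
  then obtain l r where lr: "\<phi> ` {0..1} = {l..r}" using connected_compact_interval_1 by metis
  define \<psi> where "\<psi> = inv_into {0..1} \<phi>"
  have \<psi>: "\<psi> (\<phi> t) = t" if "t \<in> {0..1}" for t
    using \<phi>(2) that by (simp add: \<psi>_def)
  have cont\<psi>: "continuous_on {l..r} \<psi>"
    using continuous_on_inv[OF \<phi>(1) compact_Icc] \<psi> lr by metis
  have \<psi>_in: "\<psi> x \<in> {0..1}" "\<phi> (\<psi> x) = x" if "x \<in> {l..r}" for x
  proof -
    have x: "x \<in> \<phi> ` {0..1}" using that lr by simp
    show "\<psi> x \<in> {0..1}" "\<phi> (\<psi> x) = x"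
      using inv_into_into[OF x] f_inv_into_f[OF x] by (simp_all add: \<psi>_def)
  qed
  define h where "h x = snd (g (\<psi> x))" for x
  have "continuous_on {0..1} g" using g(1) by (simp add: arc_def path_def)
  then have "continuous_on {l..r} (\<lambda>x. g (\<psi> x))"
    using cont\<psi> by (rule continuous_on_compose2) (use \<psi>_in in auto)
  then have conth: "continuous_on {l..r} h"
    unfolding h_def by (intro continuous_intros)
  have graph: "(x, y) \<in> C \<longleftrightarrow> x \<in> {l..r} \<and> y = h x" for x y
  proof
    assume "(x, y) \<in> C"
    then obtain t where t: "t \<in> {0..1}" "g t = (x, y)" using g(2) by (auto simp: path_image_def)
    then have "\<phi> t = x" "\<psi> x = t" using \<psi>[OF t(1)] by (auto simp: \<phi>_def)
    moreover from this have "x \<in> {l..r}" using t lr by blast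
    ultimately show "x \<in> {l..r} \<and> y = h x" using t by (simp add: h_def)
  next
    assume x: "x \<in> {l..r} \<and> y = h x"
    then have "g (\<psi> x) = (x, y)"
      using \<psi>_in[of x] by (simp add: h_def \<phi>_def prod_eq_iff)
    then show "(x, y) \<in> C" using \<psi>_in[of x] x g(2) by (metis imageI path_image_def)
  qed
  have "(x, h x) \<in> curve_interior C" if x: "l < x" "x < r" for x
  proof -
    have "(x, h x) \<notin> curve_endpoints C"
    proof
      assume "(x, h x) \<in> curve_endpoints C"
      then obtain g' where g': "arc g'" "path_image g' = C" "g' 0 = (x, h x)"
        by (auto simp: curve_endpoints_def pathstart_def)
      let ?\<theta> = "\<lambda>t. fst (g' t)"
      note \<theta> = arc_fst_image[OF g'(1,2) mono]
      have hit: "y \<in> ?\<theta> ` {0<..1}" if "y \<in> {l..r}" "y \<noteq> x" for y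
      proof -
        have "(y, h y) \<in> g' ` {0..1}" using graph that g'(2) by (simp add: path_image_def)
        then obtain t where t: "t \<in> {0..1}" "g' t = (y, h y)" by auto
        then have "t \<noteq> 0" using g'(3) that by auto
        then have "t \<in> {0<..1}" using t by auto
        then show ?thesis using t by (force intro: image_eqI[of _ _ t])
      qed
      have conn: "connected (?\<theta> ` {0<..1})"
        by (rule connected_continuous_image[OF continuous_on_subset[OF \<theta>(1)]]) auto
      have "l \<in> ?\<theta> ` {0<..1}" "r \<in> ?\<theta> ` {0<..1}" using hit[of l] hit[of r] x by auto
      from connectedD_interval[OF conn this, of x] have "x \<in> ?\<theta> ` {0<..1}" using x by simp
      then obtain t where t: "t \<in> {0<..1}" "fst (g' t) = x" by auto
      then have "t = 0" using inj_onD[OF \<theta>(2), of t 0] g'(3) by auto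
      then show False using t by simp
    qed
    then show ?thesis using graph x by (simp add: curve_interior_def)
  qed
  then show ?thesis using that conth graph by blast
qed

definition meets :: "real \<Rightarrow> ('a \<Rightarrow> real) \<Rightarrow> ('a \<Rightarrow> real \<Rightarrow> real) \<Rightarrow> 'a set \<Rightarrow> 'a \<Rightarrow> 'a \<Rightarrow> bool" where
  "meets a r h F C D \<longleftrightarrow>
     C \<in> F \<and> D \<in> F \<and> C \<noteq> D \<and> (\<exists>x. a \<le> x \<and> x \<le> r C \<and> x \<le> r D \<and> h C x = h D x)"

lemma meets_colourable:
  fixes h :: "'a \<Rightarrow> real \<Rightarrow> real"
  assumes fin: "finite F"
    and r: "\<And>C. C \<in> F \<Longrightarrow> a \<le> r C" "\<And>C. C \<in> F \<Longrightarrow> continuous_on {a..r C} (h C)"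
    and unique: "\<And>C D x y. C \<in> F \<Longrightarrow> D \<in> F \<Longrightarrow> C \<noteq> D \<Longrightarrow> x \<in> {a..min (r C) (r D)} \<Longrightarrow>
        y \<in> {a..min (r C) (r D)} \<Longrightarrow> h C x = h D x \<Longrightarrow> h C y = h D y \<Longrightarrow> x = y"
    and touch: "\<And>C D x \<delta>. C \<in> F \<Longrightarrow> D \<in> F \<Longrightarrow> C \<noteq> D \<Longrightarrow> h C x = h D x \<Longrightarrow> 0 < \<delta> \<Longrightarrow>
        {x - \<delta>..x + \<delta>} \<subseteq> {a..min (r C) (r D)} \<Longrightarrow> \<exists>y. y \<noteq> x \<and> \<bar>y - x\<bar> \<le> \<delta> \<and> h D y \<le> h C y"
    and cliques: "\<And>K. K \<subseteq> F \<Longrightarrow> \<forall>C\<in>K. \<forall>D\<in>K. C \<noteq> D \<longrightarrow> meets a r h F C D \<Longrightarrow> card K \<le> k"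
  shows "colourable (meets a r h F) F (k * clique_bound k)"
proof -
  have grounded: "grounded W a h r (meets a r h F)" if W: "W \<subseteq> F" "inj_on (\<lambda>C. h C a) W" for W
  proof
    show "finite W" using W fin finite_subset by blast
    fix C D assume CD: "C \<in> W" "D \<in> W" "h C a < h D a"
    let ?m = "min (r C) (r D)"
    have F: "C \<in> F" "D \<in> F" "C \<noteq> D" "a \<le> ?m" using CD W r(1) by auto
    have cont: "continuous_on {a..?m} (h C)" "continuous_on {a..?m} (h D)"
      using r(2)[OF F(1)] r(2)[OF F(2)] by (auto elim: continuous_on_subset)
    have co: "(\<exists>x\<in>{a..?m}. h C x = h D x) \<longleftrightarrow> h D ?m \<le> h C ?m"
      by (rule crossing_order(1)[OF cont F(4) CD(3)]) (blast intro: unique[OF F(1-3)] touch[OF F(1-3)])+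
    have "meets a r h F C D \<longleftrightarrow> (\<exists>x\<in>{a..?m}. h C x = h D x)"
      using F by (auto simp: meets_def)
    then show "meets a r h F C D \<longleftrightarrow> h D ?m \<le> h C ?m" using co by (rule trans)
    show "h D x' \<le> h C x'" if "a \<le> x" "x \<le> x'" "x' \<le> r C" "x' \<le> r D" "h D x \<le> h C x" for x x'
    proof (rule crossing_order(2)[OF cont F(4) CD(3) _ _ that(1,2) _ that(5)])
      show "x' \<le> ?m" using that by simp
    qed (blast intro: unique[OF F(1-3)] touch[OF F(1-3)])+
  next
    show "inj_on (\<lambda>C. h C a) W" using W by simp
  qed (use r W in \<open>auto simp: meets_def\<close>)
  text \<open>Curves with the same starting point form a clique; number the members of each such clique.\<close>
  have "\<exists>e. inj_on e {D \<in> F. h D a = y} \<and> e ` {D \<in> F. h D a = y} \<subseteq> {..<k}" for y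
  proof -
    let ?K = "{D \<in> F. h D a = y}"
    have "card ?K \<le> k" using r(1) by (intro cliques) (auto simp: meets_def)
    moreover obtain e where "bij_betw e ?K {0..<card ?K}"
      using ex_bij_betw_finite_nat[of ?K] fin by auto
    ultimately show ?thesis by (intro exI[of _ e]) (auto simp: bij_betw_def)
  qed
  then obtain e where e: "\<And>y. inj_on (e y) {D \<in> F. h D a = y}" "\<And>y. e y ` {D \<in> F. h D a = y} \<subseteq> {..<k}"
    by metis
  define W where "W i = {C \<in> F. e (h C a) C = i}" for i
  have "colourable (meets a r h F) (W i) (clique_bound k)" for i
  proof (rule grounded_colourable[OF grounded])
    show "W i \<subseteq> F" by (auto simp: W_def)
    show "inj_on (\<lambda>C. h C a) (W i)"
    proof (rule inj_onI)
      fix C D assume "C \<in> W i" "D \<in> W i" "h C a = h D a"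
      then show "C = D" using inj_onD[OF e(1)[of "h C a"], of C D] by (auto simp: W_def)
    qed
    show "card K \<le> k" if "K \<subseteq> W i" "\<forall>C\<in>K. \<forall>D\<in>K. C \<noteq> D \<longrightarrow> meets a r h F C D" for K
      using that by (intro cliques) (auto simp: W_def)
  qed
  then have "colourable (meets a r h F) (\<Union>i\<in>{..<k}. W i) (card {..<k} * clique_bound k)"
    by (intro colourable_UN) auto
  moreover have "F \<subseteq> (\<Union>i\<in>{..<k}. W i)"
    using e(2) by (fastforce simp: W_def)
  ultimately show ?thesis using colourable_mono by fastforce
qed

lemma chromatic_number_le:
  assumes fin: "finite F" and simple: "simple_family F" and mono: "\<forall>C\<in>F. x_monotone C"
    and line: "\<forall>C\<in>F. C \<inter> vertical_line a \<noteq> {}"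
  defines "k \<equiv> clique_number (intersection_graph F)"
  shows "chromatic_number (intersection_graph F) \<le> k * clique_bound k * (k * clique_bound k)"
proof -
  define rep where "rep C l r h \<longleftrightarrow> continuous_on {l..r} h \<and>
      (\<forall>x y. (x, y) \<in> C \<longleftrightarrow> x \<in> {l..r} \<and> y = h x) \<and>
      (\<forall>x. l < x \<and> x < r \<longrightarrow> (x, h x) \<in> curve_interior C)" for C l r and h :: "real \<Rightarrow> real"
  have "\<forall>C\<in>F. \<exists>l r h. rep C l r h"
  proof
    fix C assume "C \<in> F"
    then have C: "curve C" "x_monotone C" using simple mono by (auto simp: simple_family_def)
    obtain l r h where g: "continuous_on {l..r} h" "\<forall>x y. (x, y) \<in> C \<longleftrightarrow> x \<in> {l..r} \<and> y = h x"
      "\<forall>x. l < x \<and> x < r \<longrightarrow> (x, h x) \<in> curve_interior C"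
      by (rule x_monotone_curve_graph[OF C])
    then have "rep C l r h" unfolding rep_def by (intro conjI)
    then show "\<exists>l r h. rep C l r h" by blast
  qed
  from bchoice[OF this] obtain l where "\<forall>C\<in>F. \<exists>r h. rep C (l C) r h" ..
  from bchoice[OF this] obtain r where "\<forall>C\<in>F. \<exists>h. rep C (l C) (r C) h" ..
  from bchoice[OF this] obtain h where rep: "\<forall>C\<in>F. rep C (l C) (r C) (h C)" ..
  have lrh: "\<And>C. C \<in> F \<Longrightarrow> continuous_on {l C..r C} (h C)"
      "\<And>C x y. C \<in> F \<Longrightarrow> (x, y) \<in> C \<longleftrightarrow> x \<in> {l C..r C} \<and> y = h C x"
      "\<And>C x. C \<in> F \<Longrightarrow> l C < x \<Longrightarrow> x < r C \<Longrightarrow> (x, h C x) \<in> curve_interior C"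
    using rep[rule_format, unfolded rep_def] by auto
  have a: "l C \<le> a" "a \<le> r C" if "C \<in> F" for C
  proof -
    have "C \<inter> vertical_line a \<noteq> {}" using line that by (rule bspec)
    then obtain p where "p \<in> C" "p \<in> vertical_line a" by blast
    then have "(a, snd p) \<in> C" by (cases p) (simp add: vertical_line_def)
    then show "l C \<le> a" "a \<le> r C" using lrh(2)[OF that, of a "snd p"] by auto
  qed
  note pair = simple[unfolded simple_family_def, THEN conjunct2, THEN bspec, THEN bspec, THEN mp]
  have unique: "x = y"
    if "C \<in> F" "D \<in> F" "C \<noteq> D" "x \<in> {l C..r C} \<inter> {l D..r D}" "y \<in> {l C..r C} \<inter> {l D..r D}"
      "h C x = h D x" "h C y = h D y" for C D x y
  proof -
    have "(x, h C x) \<in> C \<inter> D" "(y, h C y) \<in> C \<inter> D"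
      using lrh(2)[OF that(1)] lrh(2)[OF that(2)] that(4-) by auto
    with pair[OF that(1-3), THEN conjunct1] have "(x, h C x) = (y, h C y)" by blast
    then show ?thesis by simp
  qed
  have touch: "\<exists>y. y \<noteq> x \<and> \<bar>y - x\<bar> \<le> \<delta> \<and> h D y \<le> h C y"
    if CD: "C \<in> F" "D \<in> F" "C \<noteq> D" and x: "h C x = h D x" "0 < \<delta>"
      "{x - \<delta>..x + \<delta>} \<subseteq> {l C..r C} \<inter> {l D..r D}" for C D x \<delta>
  proof (rule ccontr)
    assume "\<not> ?thesis"
    then have above: "\<And>y. y \<noteq> x \<Longrightarrow> \<bar>y - x\<bar> \<le> \<delta> \<Longrightarrow> h C y < h D y" by fastforce
    have in_range: "y \<in> {l C..r C}" "y \<in> {l D..r D}" if "\<bar>y - x\<bar> \<le> \<delta>" for y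
    proof -
      have "y \<in> {x - \<delta>..x + \<delta>}" using that by auto
      then show "y \<in> {l C..r C}" "y \<in> {l D..r D}" using x(3) by auto
    qed
    have "\<not> properly_cross_at C D (x, h C x)"
    proof (rule not_properly_cross_at_touching[OF x(2)])
      show "continuous_on {x - \<delta>..x + \<delta>} (h C)"
        using lrh(1)[OF CD(1)] x(3) by (auto elim: continuous_on_subset)
      show "(y, z) \<in> C \<longleftrightarrow> z = h C y" "(y, z) \<in> D \<longleftrightarrow> z = h D y" if "\<bar>y - x\<bar> \<le> \<delta>" for y z
        using lrh(2)[OF CD(1)] lrh(2)[OF CD(2)] in_range[OF that] by blast+
    qed (use x(1) above in blast)+
    moreover have "(x, h C x) \<in> curve_interior C" "(x, h D x) \<in> curve_interior D"
      using lrh(3)[OF CD(1), of x] lrh(3)[OF CD(2), of x] in_range[of "x - \<delta>"] in_range[of "x + \<delta>"] x(2) by auto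
    then have "(x, h C x) \<in> curve_interior C \<inter> curve_interior D" using x(1) by simp
    with pair[OF CD, THEN conjunct2] have "properly_cross_at C D (x, h C x)" by (rule bspec)
    ultimately show False by contradiction
  qed
  let ?adj = "\<lambda>C D. C \<in> F \<and> D \<in> F \<and> C \<noteq> D \<and> C \<inter> D \<noteq> {}"
  have edge: "{C, D} \<in> snd (intersection_graph F) \<longleftrightarrow> C \<in> F \<and> D \<in> F \<and> C \<inter> D \<noteq> {}" if "C \<noteq> D" for C D
    using that by (auto simp: intersection_graph_def doubleton_eq_iff)
  have verts: "fst (intersection_graph F) = F" by (simp add: intersection_graph_def)
  have k: "card K \<le> k" if K: "K \<subseteq> F" "\<And>C D. C \<in> K \<Longrightarrow> D \<in> K \<Longrightarrow> C \<noteq> D \<Longrightarrow> C \<inter> D \<noteq> {}" for K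
  proof -
    have "clique K (snd (intersection_graph F))"
      using K edge by (fastforce simp: clique_def)
    moreover have "finite {card K |K. K \<subseteq> F \<and> clique K (snd (intersection_graph F))}"
      by (rule finite_subset[of _ "card ` Pow F"]) (use fin in blast, use fin in simp)
    ultimately show ?thesis
      unfolding k_def clique_number_def verts using K(1) by (intro Max_ge) auto
  qed
  have right: "colourable (meets a r h F) F (k * clique_bound k)"
  proof (rule meets_colourable[OF fin])
    show "continuous_on {a..r C} (h C)" if "C \<in> F" for C
      using lrh(1)[OF that] a[OF that] by (auto elim: continuous_on_subset)
    show "card K \<le> k" if K: "K \<subseteq> F" "\<forall>C\<in>K. \<forall>D\<in>K. C \<noteq> D \<longrightarrow> meets a r h F C D" for K
    proof (rule k[OF K(1)])
      fix C D assume "C \<in> K" "D \<in> K" "C \<noteq> D"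
      then obtain x where "C \<in> F" "D \<in> F" "a \<le> x" "x \<le> r C" "x \<le> r D" "h C x = h D x"
        using K(2) unfolding meets_def by blast
      then have "(x, h C x) \<in> C \<inter> D"
        using lrh(2)[of C x "h C x"] lrh(2)[of D x "h C x"] a[of C] a[of D] by auto
      then show "C \<inter> D \<noteq> {}" by blast
    qed
    show "x = y" if "C \<in> F" "D \<in> F" "C \<noteq> D" "x \<in> {a..min (r C) (r D)}" "y \<in> {a..min (r C) (r D)}"
        "h C x = h D x" "h C y = h D y" for C D x y
      using unique[of C D x y] that a[of C] a[of D] by auto
    show "\<exists>y. y \<noteq> x \<and> \<bar>y - x\<bar> \<le> \<delta> \<and> h D y \<le> h C y"
      if "C \<in> F" "D \<in> F" "C \<noteq> D" "h C x = h D x" "0 < \<delta>" "{x - \<delta>..x + \<delta>} \<subseteq> {a..min (r C) (r D)}" for C D x \<delta>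
      using that a[of C] a[of D] by (intro touch) auto
  qed (use a in auto)
  have left: "colourable (meets (- a) (\<lambda>C. - l C) (\<lambda>C x. h C (- x)) F) F (k * clique_bound k)"
  proof (rule meets_colourable[OF fin])
    show "continuous_on {- a..- l C} (\<lambda>x. h C (- x))" if "C \<in> F" for C
      by (rule continuous_on_compose2[OF lrh(1)[OF that]]) (use a[OF that] in \<open>auto intro: continuous_intros\<close>)
    show "card K \<le> k"
      if K: "K \<subseteq> F" "\<forall>C\<in>K. \<forall>D\<in>K. C \<noteq> D \<longrightarrow> meets (- a) (\<lambda>C. - l C) (\<lambda>C x. h C (- x)) F C D" for K
    proof (rule k[OF K(1)])
      fix C D assume "C \<in> K" "D \<in> K" "C \<noteq> D"
      then obtain x where x: "C \<in> F" "D \<in> F" "- a \<le> x" "x \<le> - l C" "x \<le> - l D" "h C (- x) = h D (- x)"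
        using K(2) unfolding meets_def by blast
      then have "(- x, h C (- x)) \<in> C \<inter> D"
        using lrh(2)[of C "- x" "h C (- x)"] lrh(2)[of D "- x" "h C (- x)"] a[of C] a[of D] by auto
      then show "C \<inter> D \<noteq> {}" by blast
    qed
    show "x = y" if "C \<in> F" "D \<in> F" "C \<noteq> D" "x \<in> {- a..min (- l C) (- l D)}" "y \<in> {- a..min (- l C) (- l D)}"
        "h C (- x) = h D (- x)" "h C (- y) = h D (- y)" for C D x y
      using unique[of C D "- x" "- y"] that a[of C] a[of D] by auto
    show "\<exists>y. y \<noteq> x \<and> \<bar>y - x\<bar> \<le> \<delta> \<and> h D (- y) \<le> h C (- y)"
      if CD: "C \<in> F" "D \<in> F" "C \<noteq> D" "h C (- x) = h D (- x)" "0 < \<delta>"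
        and sub: "{x - \<delta>..x + \<delta>} \<subseteq> {- a..min (- l C) (- l D)}" for C D x \<delta>
    proof -
      have "{- x - \<delta>..- x + \<delta>} \<subseteq> {l C..r C} \<inter> {l D..r D}"
        using sub a[OF CD(1)] a[OF CD(2)] CD(5) by auto
      then obtain y where y: "y \<noteq> - x" "\<bar>y - (- x)\<bar> \<le> \<delta>" "h D y \<le> h C y"
        using touch[OF CD] by blast
      then have "- y \<noteq> x \<and> \<bar>(- y) - x\<bar> \<le> \<delta> \<and> h D (- (- y)) \<le> h C (- (- y))" by auto
      then show ?thesis by blast
    qed
  qed (use a in auto)
  have "colourable ?adj F (k * clique_bound k * (k * clique_bound k))"
  proof (rule colourable_product[OF right left])
    fix C D assume CD: "?adj C D"
    then obtain x y where "(x, y) \<in> C" "(x, y) \<in> D" by auto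
    then have x: "x \<in> {l C..r C}" "x \<in> {l D..r D}" "h C x = h D x"
      using lrh(2)[of C x y] lrh(2)[of D x y] CD by auto
    show "meets a r h F C D \<or> meets (- a) (\<lambda>C. - l C) (\<lambda>C x. h C (- x)) F C D"
    proof (cases "a \<le> x")
      case True
      then show ?thesis using x CD by (auto simp: meets_def)
    next
      case False
      then have "- a \<le> - x \<and> - x \<le> - l C \<and> - x \<le> - l D \<and> h C (- (- x)) = h D (- (- x))"
        using x by auto
      then show ?thesis using CD unfolding meets_def by blast
    qed
  qed
  then obtain c where "\<forall>C\<in>F. c C < k * clique_bound k * (k * clique_bound k)"
      "\<forall>C\<in>F. \<forall>D\<in>F. ?adj C D \<longrightarrow> c C \<noteq> c D"
    unfolding colourable_def by (elim exE conjE)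
  then have c: "c C < k * clique_bound k * (k * clique_bound k)" "?adj C D \<Longrightarrow> c C \<noteq> c D"
    if "C \<in> F" "D \<in> F" for C D
    using that by auto
  have "proper_colouring (intersection_graph F) (k * clique_bound k * (k * clique_bound k)) c"
    unfolding proper_colouring_def verts
  proof (intro conjI ballI impI)
    fix C D assume CD: "C \<in> F" "D \<in> F" "C \<noteq> D \<and> {C, D} \<in> snd (intersection_graph F)"
    then show "c C \<noteq> c D" using c(2)[OF CD(1,2)] edge[of C D] by simp
  qed (use c(1) in simp)
  then show ?thesis
    unfolding chromatic_number_def by (intro Least_le exI)
qed

theorem theorem1p1:
  shows "chi_bounded {intersection_graph F | F.
           finite F \<and> simple_family F \<and> (\<forall>C\<in>F. x_monotone C) \<and>
           (\<exists>a. \<forall>C\<in>F. C \<inter> vertical_line a \<noteq> {})}"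
  unfolding chi_bounded_def
proof (intro exI ballI)
  fix G
  assume "G \<in> {intersection_graph F | F.
           finite F \<and> simple_family F \<and> (\<forall>C\<in>F. x_monotone C) \<and>
           (\<exists>a. \<forall>C\<in>F. C \<inter> vertical_line a \<noteq> {})}"
  then obtain F a where F: "finite F" "simple_family F" "\<forall>C\<in>F. x_monotone C"
      "\<forall>C\<in>F. C \<inter> vertical_line a \<noteq> {}" and G: "G = intersection_graph F"
    by blast
  show "chromatic_number G \<le> (\<lambda>k. k * clique_bound k * (k * clique_bound k)) (clique_number G)"
    unfolding G using chromatic_number_le[OF F] .
qed

end
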